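(* Consider the projected Bellman-ADMM described in the context. Assume $A_\theta$ is uniformly invertible, $\sup_\theta\|A_\theta^{-1}\|\le\kappa_A<\infty$, and Lipschitz, $\|A_\theta-A_{\theta'}\|\le L_A\|\theta-\theta'\|$; that $D_\theta A_\theta$ and $D_\theta b_\theta$ are bounded; and that the projected reduced objective $\phi(\theta)+c_w^{\mathsf T}A_\theta^{-1}b_\theta$ is bounded below on $\Theta$. Let $A_B=3\kappa_A^4L_A^2\|c_w\|^2$ and $B_B=3\kappa_A^2/\eta_w^2$, and suppose $\frac{B_B}\beta<\tau<\frac1{2\eta_w}-\frac{B_B}\beta$; that $0<\underline\eta\le\eta_{\theta,k}$; that $\nabla h_k$ is $L_{\theta,k}$-Lipschitz on every policy comparison segment $[\theta^k,\theta^{k+1}]$ with $L_{\theta,k}\le\overline L<\infty$; and that $\frac1{2\eta_{\theta,k}}-\frac{L_{\theta,k}}2-\frac{A_B}\beta\ge\alpha_\theta>0$ for all $k$. Then the corrected projected Lyapunov function $\mathcal L^B_\beta(\theta^k,w^k,\nu^k)+\tau\|w^k-w^{k-1}\|^2$ decreases (for $k\ge1$), the projected KKT residual converges to zero, $G^B(\theta^k,w^k,\nu^k)\to0$, and the minimum squared projected KKT residual satisfies $\min_{1\le k\le T}G^B(\theta^k,w^k,\nu^k)=O(T^{-1})$.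
   Context: Norms are Euclidean/spectral. $(\mathcal S,\mathcal A,P,r,\gamma)$ is a finite discounted MDP with $0<\gamma<1$. $\Theta\subset\mathbb R^p$ is closed and convex and $\theta\mapsto\pi_\theta$ is a smooth policy map on a neighborhood of $\Theta$; $P_\theta(s'|s)=\sum_a\pi_\theta(a|s)P(s'|s,a)$, $r_\theta(s)=\sum_a\pi_\theta(a|s)r(s,a)$, $M_\theta=I-\gamma P_\theta$. $\psi_\Theta=\phi+\delta_\Theta$ ($\delta_\Theta$ the indicator) is proper, lower semicontinuous and bounded below; $\partial\psi_\Theta$ is the limiting subdifferential. Value approximation: $V_w=\Xi w$ with $\Xi\in\mathbb R^{|\mathcal S|\times m}$ of full column rank, $m<|\mathcal S|$; $D$ is a fixed positive diagonal matrix; $A_\theta=\Xi^{\mathsf T}DM_\theta\Xi$, $b_\theta=\Xi^{\mathsf T}Dr_\theta$, $c_w=\Xi^{\mathsf T}c$ with $c\in\mathbb R^{|\mathcal S|}$. The projected Bellman equation is $A_\theta w-b_\theta=0$, and the problem is $\min_{\theta\in\Theta,w}\phi(\theta)+c_w^{\mathsf T}w$ subject to it. Projected augmented Lagrangian: $\mathcal L^B_\beta(\theta,w,\nu)=\phi(\theta)+c_w^{\mathsf T}w+\langle\nu,A_\theta w-b_\theta\rangle+\frac\beta2\|A_\theta w-b_\theta\|^2$. Squared projected KKT residual: $G^B(\theta,w,\nu)=\operatorname{dist}^2(0,\partial\psi_\Theta(\theta)+D_\theta(A_\theta w-b_\theta)^{\mathsf T}\nu)+\|c_w+A_\theta^{\mathsf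 T}\nu\|^2+\|A_\theta w-b_\theta\|^2$. Algorithm (deterministic, $\beta,\eta_w,\eta_{\theta,k}>0$), from $\theta^0\in\operatorname{dom}\psi_\Theta$ and finite $w^0,\nu^0$: with $h_k(\theta)=\langle\nu^k,A_\theta w^k-b_\theta\rangle+\frac\beta2\|A_\theta w^k-b_\theta\|^2$, for $k\ge0$, $\theta^{k+1}\in\arg\min_{\theta\in\Theta}\{\phi(\theta)+\langle\nabla h_k(\theta^k),\theta-\theta^k\rangle+\frac1{2\eta_{\theta,k}}\|\theta-\theta^k\|^2\}$; $w^{k+1}=\arg\min_w\{\mathcal L^B_\beta(\theta^{k+1},w,\nu^k)+\frac1{2\eta_w}\|w-w^k\|^2\}$; $\nu^{k+1}=\nu^k+\beta(A_{\theta^{k+1}}w^{k+1}-b_{\theta^{k+1}})$. *)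

theory Defs
  imports "HOL-Analysis.Analysis"
begin

section \<open>Nonsmooth analysis\<close>

definition indicator_ext :: "'x set \<Rightarrow> 'x \<Rightarrow> ereal" where
  "indicator_ext S x = (if x \<in> S then 0 else \<infinity>)"

definition dom_ext :: "('x \<Rightarrow> ereal) \<Rightarrow> 'x set" where
  "dom_ext f = {x. f x < \<infinity>}"

definition proper_fun :: "('x \<Rightarrow> ereal) \<Rightarrow> bool" where
  "proper_fun f \<longleftrightarrow> (\<forall>x. f x \<noteq> - \<infinity>) \<and> dom_ext f \<noteq> {}"

definition lsc_fun :: "('x::topological_space \<Rightarrow> ereal) \<Rightarrow> bool" where
  "lsc_fun f \<longleftrightarrow> (\<forall>x. f x \<le> Liminf (at x) f)"

definition bounded_below_on :: "'x set \<Rightarrow> ('x \<Rightarrow> ereal) \<Rightarrow> bool" where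
  "bounded_below_on S f \<longleftrightarrow> (\<exists>m::real. \<forall>x\<in>S. ereal m \<le> f x)"

text \<open>The regular (Frechet) subdifferential: the subgradient inequality
  \<open>f y \<ge> f x + \<langle>v, y - x\<rangle> + o(\<parallel>y - x\<parallel>)\<close> as \<open>y \<rightarrow> x\<close>, at points where \<open>f\<close> is finite.\<close>

definition regular_subdiff :: "('x::real_inner \<Rightarrow> ereal) \<Rightarrow> 'x \<Rightarrow> 'x set" where
  "regular_subdiff f x =
     {v. \<bar>f x\<bar> \<noteq> \<infinity> \<and>
         (\<forall>\<epsilon>>0. \<forall>\<^sub>F y in at x. f x + ereal (inner v (y - x) - \<epsilon> * norm (y - x)) \<le> f y)}"

definition limiting_subdiff :: "('x::real_inner \<Rightarrow> ereal) \<Rightarrow> 'x \<Rightarrow> 'x set" where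
  "limiting_subdiff f x =
     {v. \<bar>f x\<bar> \<noteq> \<infinity> \<and>
         (\<exists>xs vs. xs \<longlonglongrightarrow> x \<and> (\<lambda>n. f (xs n)) \<longlonglongrightarrow> f x \<and>
                  (\<forall>n. vs n \<in> regular_subdiff f (xs n)) \<and> vs \<longlonglongrightarrow> v)}"

text \<open>The library's \<open>infdist\<close> makes the distance to the empty set \<open>0\<close>; here it is \<open>\<infinity>\<close>, so that a
  point with empty subdifferential is not counted as stationary.\<close>

definition dist_ext :: "'x::metric_space \<Rightarrow> 'x set \<Rightarrow> ereal" where
  "dist_ext x S = (INF y\<in>S. ereal (dist x y))"

definition gradient :: "('x::real_inner \<Rightarrow> real) \<Rightarrow> 'x \<Rightarrow> 'x" where
  "gradient f x = (THE g. GDERIV f x :> g)"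

definition continuously_diff_on :: "'x::real_normed_vector set \<Rightarrow> ('x \<Rightarrow> real) \<Rightarrow> bool" where
  "continuously_diff_on U f \<longleftrightarrow>
     (\<exists>f'. (\<forall>x\<in>U. (f has_derivative blinfun_apply (f' x)) (at x)) \<and> continuous_on U f')"

text \<open>The norm on the matrix type is the Frobenius norm, so the spectral norm is the operator norm of
  the induced map.\<close>

definition spectral_norm :: "real^'n^'m \<Rightarrow> real" where
  "spectral_norm A = onorm ((*v) A)"


section \<open>Finite discounted MDPs and the projected Bellman equation\<close>

definition finite_discounted_mdp :: "('s::finite \<Rightarrow> 'a::finite \<Rightarrow> 's \<Rightarrow> real) \<Rightarrow> real \<Rightarrow> bool" where
  "finite_discounted_mdp P \<gamma> \<longleftrightarrow>
     (\<forall>s a. (\<forall>s'. 0 \<le> P s a s') \<and> (\<Sum>s'\<in>UNIV. P s a s') = 1) \<and> 0 < \<gamma> \<and> \<gamma> < 1"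

definition policy :: "('s \<Rightarrow> 'a::finite \<Rightarrow> real) \<Rightarrow> bool" where
  "policy p \<longleftrightarrow> (\<forall>s. (\<forall>a. 0 \<le> p s a) \<and> (\<Sum>a\<in>UNIV. p s a) = 1)"

text \<open>The neighbourhood carries only the smoothness: the values are required to be policies on
  \<open>\<Theta>\<close>, which admits, for example, the direct parametrization.  Smooth means \<open>C\<^sup>1\<close>.\<close>

definition smooth_policy_map ::
    "'x::real_normed_vector set \<Rightarrow> ('x \<Rightarrow> 's \<Rightarrow> 'a::finite \<Rightarrow> real) \<Rightarrow> bool" where
  "smooth_policy_map \<Theta> \<pi> \<longleftrightarrow>
     (\<forall>\<theta>\<in>\<Theta>. policy (\<pi> \<theta>)) \<and>
     (\<exists>U. open U \<and> \<Theta> \<subseteq> U \<and> (\<forall>s a. continuously_diff_on U (\<lambda>\<theta>. \<pi> \<theta> s a)))"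

definition policy_transition ::
    "('s::finite \<Rightarrow> 'a::finite \<Rightarrow> 's \<Rightarrow> real) \<Rightarrow> ('s \<Rightarrow> 'a \<Rightarrow> real) \<Rightarrow> real^'s^'s" where
  "policy_transition P p = (\<chi> s s'. \<Sum>a\<in>UNIV. p s a * P s a s')"

definition policy_reward ::
    "('s::finite \<Rightarrow> 'a::finite \<Rightarrow> real) \<Rightarrow> ('s \<Rightarrow> 'a \<Rightarrow> real) \<Rightarrow> real^'s" where
  "policy_reward r p = (\<chi> s. \<Sum>a\<in>UNIV. p s a * r s a)"

definition bellman_matrix ::
    "('s::finite \<Rightarrow> 'a::finite \<Rightarrow> 's \<Rightarrow> real) \<Rightarrow> real \<Rightarrow> ('s \<Rightarrow> 'a \<Rightarrow> real) \<Rightarrow> real^'s^'s" where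
  "bellman_matrix P \<gamma> p = mat 1 - \<gamma> *\<^sub>R policy_transition P p"

definition positive_diagonal :: "real^'s^'s \<Rightarrow> bool" where
  "positive_diagonal D \<longleftrightarrow> (\<forall>i j. i \<noteq> j \<longrightarrow> D $ i $ j = 0) \<and> (\<forall>i. 0 < D $ i $ i)"

definition proj_bellman_matrix ::
    "real^'m^'s \<Rightarrow> real^'s^'s \<Rightarrow> ('s::finite \<Rightarrow> 'a::finite \<Rightarrow> 's \<Rightarrow> real) \<Rightarrow> real \<Rightarrow>
     ('s \<Rightarrow> 'a \<Rightarrow> real) \<Rightarrow> real^'m^'m" where
  "proj_bellman_matrix \<Xi> D P \<gamma> p = transpose \<Xi> ** D ** bellman_matrix P \<gamma> p ** \<Xi>"

definition proj_bellman_rhs ::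
    "real^'m^'s \<Rightarrow> real^'s^'s \<Rightarrow> ('s::finite \<Rightarrow> 'a::finite \<Rightarrow> real) \<Rightarrow>
     ('s \<Rightarrow> 'a \<Rightarrow> real) \<Rightarrow> real^'m" where
  "proj_bellman_rhs \<Xi> D r p = (transpose \<Xi> ** D) *v policy_reward r p"


section \<open>Projected augmented Lagrangian, KKT residual and the ADMM iteration\<close>

text \<open>Below, \<open>A\<close> and \<open>b\<close> are the maps \<open>\<theta> \<mapsto> A\<^sub>\<theta>\<close> and \<open>\<theta> \<mapsto> b\<^sub>\<theta>\<close>,
  and \<open>cw\<close> is the projected cost vector.\<close>

definition bellman_residual ::
    "('x \<Rightarrow> real^'m^'m) \<Rightarrow> ('x \<Rightarrow> real^'m) \<Rightarrow> real^'m \<Rightarrow> 'x \<Rightarrow> real^'m" where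
  "bellman_residual A b w \<theta> = A \<theta> *v w - b \<theta>"

definition aug_lagrangian ::
    "('x \<Rightarrow> ereal) \<Rightarrow> real^'m \<Rightarrow> ('x \<Rightarrow> real^'m^'m) \<Rightarrow> ('x \<Rightarrow> real^'m) \<Rightarrow> real \<Rightarrow>
     'x \<Rightarrow> real^'m \<Rightarrow> real^'m \<Rightarrow> ereal" where
  "aug_lagrangian \<phi> cw A b \<beta> \<theta> w \<nu> =
     \<phi> \<theta> + ereal (inner cw w + inner \<nu> (bellman_residual A b w \<theta>)
                  + \<beta> / 2 * (norm (bellman_residual A b w \<theta>))\<^sup>2)"

definition policy_coupling ::
    "('x \<Rightarrow> real^'m^'m) \<Rightarrow> ('x \<Rightarrow> real^'m) \<Rightarrow> real \<Rightarrow> real^'m \<Rightarrow> real^'m \<Rightarrow> 'x \<Rightarrow> real" where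
  "policy_coupling A b \<beta> w \<nu> \<theta> =
     inner \<nu> (bellman_residual A b w \<theta>) + \<beta> / 2 * (norm (bellman_residual A b w \<theta>))\<^sup>2"

definition kkt_residual ::
    "('x::euclidean_space \<Rightarrow> ereal) \<Rightarrow> real^'m \<Rightarrow> ('x \<Rightarrow> real^'m^'m) \<Rightarrow> ('x \<Rightarrow> real^'m) \<Rightarrow>
     'x \<Rightarrow> real^'m \<Rightarrow> real^'m \<Rightarrow> ereal" where
  "kkt_residual \<psi> cw A b \<theta> w \<nu> =
     (dist_ext 0 ((\<lambda>v. v + adjoint (frechet_derivative (bellman_residual A b w) (at \<theta>)) \<nu>)
                  ` limiting_subdiff \<psi> \<theta>))\<^sup>2
     + ereal ((norm (cw + transpose (A \<theta>) *v \<nu>))\<^sup>2)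
     + ereal ((norm (bellman_residual A b w \<theta>))\<^sup>2)"

definition proj_bellman_admm ::
    "'x::euclidean_space set \<Rightarrow> ('x \<Rightarrow> ereal) \<Rightarrow> real^'m \<Rightarrow> ('x \<Rightarrow> real^'m^'m) \<Rightarrow> ('x \<Rightarrow> real^'m) \<Rightarrow>
     real \<Rightarrow> real \<Rightarrow> (nat \<Rightarrow> real) \<Rightarrow>
     (nat \<Rightarrow> 'x) \<Rightarrow> (nat \<Rightarrow> real^'m) \<Rightarrow> (nat \<Rightarrow> real^'m) \<Rightarrow> bool" where
  "proj_bellman_admm \<Theta> \<phi> cw A b \<beta> \<eta>w \<eta>\<theta> \<theta> w \<nu> \<longleftrightarrow>
     \<theta> 0 \<in> dom_ext (\<lambda>x. \<phi> x + indicator_ext \<Theta> x) \<and>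
     (\<forall>k.
       is_arg_min
         (\<lambda>x. \<phi> x + ereal (inner (gradient (policy_coupling A b \<beta> (w k) (\<nu> k)) (\<theta> k)) (x - \<theta> k)
                          + 1 / (2 * \<eta>\<theta> k) * (norm (x - \<theta> k))\<^sup>2))
         (\<lambda>x. x \<in> \<Theta>) (\<theta> (Suc k)) \<and>
       is_arg_min
         (\<lambda>u. aug_lagrangian \<phi> cw A b \<beta> (\<theta> (Suc k)) u (\<nu> k)
              + ereal (1 / (2 * \<eta>w) * (norm (u - w k))\<^sup>2))
         (\<lambda>u. True) (w (Suc k)) \<and>
       \<nu> (Suc k) = \<nu> k + \<beta> *\<^sub>R (A (\<theta> (Suc k)) *v w (Suc k) - b (\<theta> (Suc k))))"

definition lyapunov ::
    "('x \<Rightarrow> ereal) \<Rightarrow> real^'m \<Rightarrow> ('x \<Rightarrow> real^'m^'m) \<Rightarrow> ('x \<Rightarrow> real^'m) \<Rightarrow> real \<Rightarrow> real \<Rightarrow>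
     (nat \<Rightarrow> 'x) \<Rightarrow> (nat \<Rightarrow> real^'m) \<Rightarrow> (nat \<Rightarrow> real^'m) \<Rightarrow> nat \<Rightarrow> ereal" where
  "lyapunov \<phi> cw A b \<beta> \<tau> \<theta> w \<nu> k =
     aug_lagrangian \<phi> cw A b \<beta> (\<theta> k) (w k) (\<nu> k) + ereal (\<tau> * (norm (w k - w (k - 1)))\<^sup>2)"

end

theory Submission
  imports Defs
begin

text \<open>The optimality condition of the value step reads
  \<open>A\<^sup>T \<nu> + cw + dw / \<eta>w = 0\<close> at the new iterate, so the multiplier is a Lipschitz function of the policy
  and of the value increment.  This bounds the squared dual increment by \<open>AB\<close> and \<open>BB\<close> times the
  squared primal increments, the last two value increments included; the term \<open>\<tau> \<parallel>dw\<parallel>\<^sup>2\<close> of the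
  Lyapunov function pays for the older one.  The same formula turns the augmented Lagrangian into the
  reduced objective up to terms absorbed by \<open>\<tau> \<parallel>dw\<parallel>\<^sup>2\<close> and the penalty, whence a lower bound and summable
  squared increments.  Finally the three optimality conditions bound the KKT residual by the squared
  increments of the last step.\<close>

section \<open>Spectral norm and gradients\<close>

lemma norm_matrix_vector_le_spectral_norm:
  fixes B :: "real^'n^'m"
  shows "norm (B *v x) \<le> spectral_norm B * norm x"
  unfolding spectral_norm_def by (rule onorm) simp

lemma spectral_norm_nonneg: "0 \<le> spectral_norm (B :: real^'n^'m)"
  unfolding spectral_norm_def by (rule onorm_pos_le) simp

text \<open>Bilinear maps on finite-dimensional spaces are bounded. This converts Frobenius bounds
  on matrices, which come from linearity, into spectral ones.\<close>

lemma spectral_norm_le_norm: "\<exists>C\<ge>0. \<forall>B :: real^'n^'m. spectral_norm B \<le> C * norm B"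
proof -
  have "bilinear (\<lambda>(B :: real^'n^'m) x. B *v x)"
    by (auto simp: bilinear_def intro!: linearI
        simp: matrix_vector_mult_add_rdistrib scaleR_matrix_vector_assoc)
  then obtain C where "C > 0" "\<And>(B :: real^'n^'m) x. norm (B *v x) \<le> norm B * norm x * C"
    using bounded_bilinear.pos_bounded by (metis bilinear_conv_bounded_bilinear)
  then have "spectral_norm B \<le> C * norm B" for B :: "real^'n^'m"
    unfolding spectral_norm_def by (intro onorm_bound) (auto simp: algebra_simps)
  with \<open>C > 0\<close> show ?thesis by (intro exI[of _ C]) auto
qed

text \<open>Pairing \<open>transpose B *v x\<close> with itself moves the transpose to the other
  factor; after Cauchy-Schwarz one factor \<open>norm ?y\<close> cancels.\<close>

lemma norm_transpose_vector_le_spectral_norm: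
  fixes B :: "real^'n^'m"
  shows "norm (transpose B *v x) \<le> spectral_norm B * norm x"
proof -
  let ?y = "transpose B *v x"
  have "norm ?y * norm ?y = inner x (B *v ?y)"
    by (simp add: dot_lmul_matrix power2_norm_eq_inner flip: power2_eq_square)
  also have "\<dots> \<le> norm x * (spectral_norm B * norm ?y)"
    by (rule order_trans[OF norm_cauchy_schwarz])
       (intro mult_left_mono norm_matrix_vector_le_spectral_norm norm_ge_zero)
  finally have "norm ?y * norm ?y \<le> (spectral_norm B * norm x) * norm ?y"
    by (simp add: algebra_simps)
  then show ?thesis
    by (cases "norm ?y = 0")
       (use spectral_norm_nonneg[of B] in \<open>auto simp: mult_le_cancel_right\<close>)
qed

lemma spectral_norm_matrix_mult_le:
  fixes B :: "real^'n^'m" and C :: "real^'k^'n"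
  shows "spectral_norm (B ** C) \<le> spectral_norm B * spectral_norm C"
proof -
  have "(*v) (B ** C) = (*v) B \<circ> (*v) C"
    by (simp add: fun_eq_iff matrix_vector_mul_assoc)
  then show ?thesis
    unfolding spectral_norm_def by (simp add: onorm_compose)
qed

lemma matrix_inv_left_right:
  fixes B :: "real^'n^'n"
  assumes "invertible B"
  shows "B ** matrix_inv B = mat 1" "matrix_inv B ** B = mat 1"
proof -
  have "\<exists>B'. B ** B' = mat 1 \<and> B' ** B = mat 1"
    using assms by (simp add: invertible_def)
  then have "B ** matrix_inv B = mat 1 \<and> matrix_inv B ** B = mat 1"
    unfolding matrix_inv_def by (rule someI_ex)
  then show "B ** matrix_inv B = mat 1" "matrix_inv B ** B = mat 1" by auto
qed

text \<open>The resolvent identity. It makes the inverse Lipschitz with constant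
  \<open>\<kappa>A * LA * \<kappa>A\<close> along the policies.\<close>

lemma matrix_inv_diff:
  fixes B C :: "real^'n^'n"
  assumes "invertible B" "invertible C"
  shows "matrix_inv B - matrix_inv C = matrix_inv B ** (C - B) ** matrix_inv C"
proof -
  have "(matrix_inv B ** (C - B) ** matrix_inv C) *v x = (matrix_inv B - matrix_inv C) *v x" for x
  proof -
    have "(matrix_inv B ** (C - B) ** matrix_inv C) *v x
        = (matrix_inv B ** (C ** matrix_inv C)) *v x - (matrix_inv B ** B ** matrix_inv C) *v x"
      by (simp add: matrix_vector_mult_diff_rdistrib matrix_vector_mult_diff_distrib
          flip: matrix_vector_mul_assoc)
    then show ?thesis
      by (simp add: matrix_inv_left_right assms matrix_vector_mult_diff_rdistrib)
  qed
  then show ?thesis by (metis matrix_eq)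
qed

lemma transpose_diff: "transpose (B - C) = transpose B - transpose C" for B C :: "real^'n^'m"
  by (simp add: transpose_def vec_eq_iff)

lemma gradient_eqI: "GDERIV f x :> g \<Longrightarrow> gradient f x = g"
  for f :: "'x::real_inner \<Rightarrow> real"
  unfolding gradient_def
proof (rule the_equality)
  fix g' assume g: "GDERIV f x :> g" and "GDERIV f x :> g'"
  then have "(\<lambda>h. inner h g) = (\<lambda>h. inner h g')"
    unfolding gderiv_def by (rule has_derivative_unique)
  then have "inner (g' - g) (g' - g) = 0"
    by (metis diff_self inner_diff_right)
  then show "g' = g" by simp
qed

text \<open>The descent lemma, with the Lipschitz bound required on the segment only, since the
  step-size condition controls nothing beyond it.\<close>

lemma lipschitz_gradient_descent:
  fixes f :: "'x::real_inner \<Rightarrow> real"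
  assumes deriv: "\<And>z. z \<in> closed_segment x y \<Longrightarrow> GDERIV f z :> g z"
    and lip: "L-lipschitz_on (closed_segment x y) g"
  shows "f y \<le> f x + inner (g x) (y - x) + L / 2 * (norm (y - x))\<^sup>2"
proof -
  define z where "z t = x + t *\<^sub>R (y - x)" for t :: real
  \<comment> \<open>\<open>u\<close> is \<open>f\<close> along the segment minus its quadratic upper
    model. The Lipschitz bound makes its derivative nonpositive on [0,1], and
    \<open>u 1 \<le> u 0\<close> is the claim.\<close>
  define u where "u t = f (z t) - t * inner (g x) (y - x) - t\<^sup>2 * (L / 2 * (norm (y - x))\<^sup>2)" for t
  have seg: "z t \<in> closed_segment x y" if "0 \<le> t" "t \<le> 1" for t
    using that unfolding z_def closed_segment_def
    by (auto intro!: exI[of _ t] simp: algebra_simps)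
  have "u 1 \<le> u 0"
  proof (rule DERIV_nonpos_imp_nonincreasing[of 0 1 u])
    fix t :: real assume t: "0 \<le> t" "t \<le> 1"
    have "(f has_derivative (\<lambda>h. inner h (g (z t)))) (at (z t))"
      using deriv[OF seg[OF t]] by (simp add: gderiv_def)
    moreover have "(z has_derivative (\<lambda>s. s *\<^sub>R (y - x))) (at t)"
      unfolding z_def by (auto intro!: derivative_eq_intros)
    ultimately have "((\<lambda>t. f (z t)) has_derivative (\<lambda>s. inner (s *\<^sub>R (y - x)) (g (z t)))) (at t)"
      by (rule has_derivative_compose[rotated])
    then have fz: "((\<lambda>t. f (z t)) has_real_derivative inner (y - x) (g (z t))) (at t)"
      by (simp add: has_field_derivative_def mult_commute_abs)
    have "(u has_real_derivative
        inner (y - x) (g (z t)) - inner (g x) (y - x) - 2 * t * (L / 2 * (norm (y - x))\<^sup>2)) (at t)"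
      unfolding u_def by (rule fz derivative_eq_intros refl | simp)+
    moreover have "inner (y - x) (g (z t)) - inner (g x) (y - x) \<le> L * t * (norm (y - x))\<^sup>2"
    proof -
      have "inner (y - x) (g (z t)) - inner (g x) (y - x) = inner (y - x) (g (z t) - g x)"
        by (simp add: inner_diff_right inner_commute)
      also have "\<dots> \<le> norm (y - x) * norm (g (z t) - g x)"
        by (rule norm_cauchy_schwarz)
      also have "\<dots> \<le> norm (y - x) * (L * norm (z t - x))"
        using lipschitz_onD[OF lip seg[OF t], of x]
        by (intro mult_left_mono) (auto simp: dist_norm)
      also have "norm (z t - x) = t * norm (y - x)"
        using t by (simp add: z_def)
      finally show ?thesis
        by (simp add: power2_eq_square mult_ac)
    qed
    ultimately show "\<exists>d. (u has_real_derivative d) (at t) \<and> d \<le> 0"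
      by (auto intro!: exI simp: mult_ac)
  qed simp
  then show ?thesis by (simp add: u_def z_def)
qed


section \<open>Dependence of the projected Bellman equation on the policy\<close>

text \<open>A linear combination of fixed matrices with the policy entries as coefficients:
  differentiability in the policy parameter and bounds uniform over policies can then be read off
  termwise.\<close>

lemma policy_transition_eq_sum:
  "policy_transition P p =
     (\<Sum>s\<in>UNIV. \<Sum>a\<in>UNIV. p s a *\<^sub>R (\<chi> i j. if i = s then P s a j else 0))"
  by (simp add: policy_transition_def vec_eq_iff sum_component if_distrib[where f = "\<lambda>x. _ * x"]
      sum.swap[of _ "UNIV :: 'b set" "UNIV :: 'a set"] cong: if_cong)

lemma policy_reward_eq_sum:
  "policy_reward r p = (\<Sum>s\<in>UNIV. \<Sum>a\<in>UNIV. p s a *\<^sub>R (\<chi> i. if i = s then r s a else 0))"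
  by (simp add: policy_reward_def vec_eq_iff sum_component if_distrib[where f = "\<lambda>x. _ * x"]
      sum.swap[of _ "UNIV :: 'b set" "UNIV :: 'a set"] cong: if_cong)

lemma bounded_linear_matrix_sandwich:
  "bounded_linear (\<lambda>B. E ** B ** X)" for E :: "real^'n^'m" and X :: "real^'k^'l"
proof (rule linear_conv_bounded_linear[THEN iffD1], rule linearI)
  fix B C :: "real^'l^'n" and c :: real
  have "(E ** (B + C) ** X) *v v = (E ** B ** X + E ** C ** X) *v v" for v
    by (simp add: matrix_vector_mult_add_rdistrib matrix_vector_right_distrib
        flip: matrix_vector_mul_assoc)
  then show "E ** (B + C) ** X = E ** B ** X + E ** C ** X"
    by (metis matrix_eq)
  have "(E ** (c *\<^sub>R B) ** X) *v v = (c *\<^sub>R (E ** B ** X)) *v v" for v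
    by (simp add: matrix_vector_mult_scaleR flip: matrix_vector_mul_assoc scaleR_matrix_vector_assoc)
  then show "E ** (c *\<^sub>R B) ** X = c *\<^sub>R (E ** B ** X)"
    by (metis matrix_eq)
qed

lemma differentiable_policy_sum:
  fixes N :: "'s::finite \<Rightarrow> 'a::finite \<Rightarrow> 'v::real_normed_vector"
  assumes "smooth_policy_map \<Theta> \<pi>" "x \<in> \<Theta>"
  shows "(\<lambda>x. \<Sum>s\<in>UNIV. \<Sum>a\<in>UNIV. \<pi> x s a *\<^sub>R N s a) differentiable (at x)"
proof -
  have "(\<lambda>x. \<pi> x s a) differentiable (at x)" for s a
    using assms unfolding smooth_policy_map_def continuously_diff_on_def
    by (meson differentiableI subsetD)
  then show ?thesis
    by (intro differentiable_sum ballI differentiable_scaleR) auto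
qed

text \<open>Entries of a policy lie in [0,1], so the bound does not depend on the policy. This gives
  uniform bounds on \<Theta> without compactness.\<close>

lemma norm_policy_sum_le:
  fixes N :: "'s::finite \<Rightarrow> 'a::finite \<Rightarrow> 'v::real_normed_vector"
  assumes "policy p"
  shows "norm (\<Sum>s\<in>UNIV. \<Sum>a\<in>UNIV. p s a *\<^sub>R N s a) \<le> (\<Sum>s\<in>UNIV. \<Sum>a\<in>UNIV. norm (N s a))"
proof (intro sum_norm_le)
  fix s a
  have "p s a \<le> (\<Sum>a\<in>UNIV. p s a)"
    using assms by (intro member_le_sum) (auto simp: policy_def)
  then have "\<bar>p s a\<bar> \<le> 1" using assms by (auto simp: policy_def)
  then show "norm (p s a *\<^sub>R N s a) \<le> norm (N s a)"
    by (simp add: mult_left_le_one_le)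
qed

lemma differentiable_bounded_linear:
  assumes "bounded_linear T" "f differentiable (at x)"
  shows "(\<lambda>x. T (f x)) differentiable (at x)"
  using assms bounded_linear.has_derivative unfolding differentiable_def by blast

lemma proj_bellman_matrix_differentiable:
  assumes "smooth_policy_map \<Theta> \<pi>" "x \<in> \<Theta>"
  shows "(\<lambda>x. proj_bellman_matrix \<Xi> D P \<gamma> (\<pi> x)) differentiable (at x)"
  unfolding proj_bellman_matrix_def bellman_matrix_def policy_transition_eq_sum
  by (intro differentiable_bounded_linear[OF bounded_linear_matrix_sandwich] differentiable_diff
      differentiable_const differentiable_bounded_linear[OF bounded_linear_scaleR_right]
      differentiable_policy_sum[OF assms])

lemma proj_bellman_rhs_differentiable:
  assumes "smooth_policy_map \<Theta> \<pi>" "x \<in> \<Theta>"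
  shows "(\<lambda>x. proj_bellman_rhs \<Xi> D r (\<pi> x)) differentiable (at x)"
  unfolding proj_bellman_rhs_def policy_reward_eq_sum
  by (intro differentiable_bounded_linear[OF matrix_vector_mul_bounded_linear]
      differentiable_policy_sum[OF assms])

lemma proj_bellman_matrix_bounded:
  fixes \<Xi> :: "real^'m^'s" and P :: "'s::finite \<Rightarrow> 'a::finite \<Rightarrow> 's \<Rightarrow> real"
  shows "\<exists>K. \<forall>p. policy p \<longrightarrow> spectral_norm (proj_bellman_matrix \<Xi> D P \<gamma> p) \<le> K"
proof -
  obtain K where K: "\<And>B. norm (transpose \<Xi> ** D ** B ** \<Xi>) \<le> norm B * K" "0 < K"
    using bounded_linear.pos_bounded[OF bounded_linear_matrix_sandwich[of "transpose \<Xi> ** D" \<Xi>]]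
    by blast
  obtain R where "\<And>p. policy p \<Longrightarrow> norm (policy_transition P p) \<le> R"
    using norm_policy_sum_le[where N = "\<lambda>s a. \<chi> i j. if i = s then P s a j else 0"]
    by (simp add: policy_transition_eq_sum) blast
  then have "norm (bellman_matrix P \<gamma> p) \<le> norm (mat 1 :: real^'s^'s) + \<bar>\<gamma>\<bar> * R" if "policy p" for p
    unfolding bellman_matrix_def using that
    by (intro order_trans[OF norm_triangle_ineq4] add_mono) (auto intro!: mult_left_mono)
  then have "norm (proj_bellman_matrix \<Xi> D P \<gamma> p)
      \<le> (norm (mat 1 :: real^'s^'s) + \<bar>\<gamma>\<bar> * R) * K" if "policy p" for p
    unfolding proj_bellman_matrix_def using that K(2)
    by (intro order_trans[OF K(1)]) auto
  moreover obtain C where C: "\<And>B :: real^'m^'m. spectral_norm B \<le> C * norm B" "0 \<le> C"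
    using spectral_norm_le_norm by blast
  ultimately have "spectral_norm (proj_bellman_matrix \<Xi> D P \<gamma> p)
      \<le> C * ((norm (mat 1 :: real^'s^'s) + \<bar>\<gamma>\<bar> * R) * K)" if "policy p" for p
    using that by (intro order_trans[OF C(1)] mult_left_mono) auto
  then show ?thesis by blast
qed

lemma proj_bellman_rhs_bounded: "\<exists>K. \<forall>p. policy p \<longrightarrow> norm (proj_bellman_rhs \<Xi> D r p) \<le> K"
proof -
  obtain R where "\<And>p. policy p \<Longrightarrow> norm (policy_reward r p) \<le> R"
    using norm_policy_sum_le[where N = "\<lambda>s a. \<chi> i. if i = s then r s a else 0"]
    by (simp add: policy_reward_eq_sum) blast
  then have "norm (proj_bellman_rhs \<Xi> D r p) \<le> spectral_norm (transpose \<Xi> ** D) * R" if "policy p" for p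
    unfolding proj_bellman_rhs_def using that spectral_norm_nonneg
    by (intro order_trans[OF norm_matrix_vector_le_spectral_norm] mult_left_mono) auto
  then show ?thesis by blast
qed

section \<open>Subgradients from proximal steps and rates from summability\<close>

text \<open>Expanding the square around the minimizer \<open>x\<close> turns minimality into a
  global lower bound for \<psi> that is linear up to \<open>t * (norm (y - x))\<^sup>2\<close>; such
  a proximal subgradient is regular, hence limiting. No convexity of \<phi> enters.\<close>

lemma proximal_step_subgradient:
  fixes \<phi> :: "'x::real_inner \<Rightarrow> ereal"
  assumes psi: "\<psi> = (\<lambda>x. \<phi> x + indicator_ext S x)"
    and x: "x \<in> S" "\<bar>\<phi> x\<bar> \<noteq> \<infinity>"
    and t: "0 < t"
    and min: "\<And>y. y \<in> S \<Longrightarrow> \<phi> x + ereal (inner g (x - z) + t * (norm (x - z))\<^sup>2)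
                  \<le> \<phi> y + ereal (inner g (y - z) + t * (norm (y - z))\<^sup>2)"
  shows "- g - (2 * t) *\<^sub>R (x - z) \<in> limiting_subdiff \<psi> x"
proof -
  let ?v = "- g - (2 * t) *\<^sub>R (x - z)"
  obtain p where p: "\<phi> x = ereal p" using x(2) by (cases "\<phi> x") auto
  have psi_x: "\<psi> x = ereal p" by (simp add: psi x indicator_ext_def p)
  have ineq: "\<psi> x + ereal (inner ?v (y - x) - t * (norm (y - x))\<^sup>2) \<le> \<psi> y" for y
  proof (cases "y \<in> S")
    case True
    have sq: "(norm (y - z))\<^sup>2 = (norm (y - x))\<^sup>2 + 2 * inner (x - z) (y - x) + (norm (x - z))\<^sup>2"
      by (simp add: power2_norm_eq_inner inner_diff_left inner_diff_right inner_commute)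
    have eq: "inner g (x - z) + t * (norm (x - z))\<^sup>2
        = (inner ?v (y - x) - t * (norm (y - x))\<^sup>2) + (inner g (y - z) + t * (norm (y - z))\<^sup>2)"
      by (simp add: sq inner_diff_left inner_diff_right algebra_simps)
    show ?thesis
      using min[OF True] by (cases "\<phi> y") (auto simp: psi_x psi True indicator_ext_def p eq x)
  qed (simp add: psi indicator_ext_def)
  have "\<forall>\<^sub>F y in at x. \<psi> x + ereal (inner ?v (y - x) - \<epsilon> * norm (y - x)) \<le> \<psi> y" if "\<epsilon> > 0" for \<epsilon>
    unfolding eventually_at
  \<comment> \<open>Within radius \<open>\<epsilon> / t\<close> the quadratic error is at most
    \<open>\<epsilon> * norm (y - x)\<close>.\<close>
  proof (intro exI[of _ "\<epsilon> / t"] conjI ballI impI)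
    show "0 < \<epsilon> / t" using that t by simp
    fix y assume "y \<noteq> x \<and> dist y x < \<epsilon> / t"
    then have "t * norm (y - x) \<le> \<epsilon>"
      using t by (simp add: dist_norm pos_less_divide_eq mult.commute)
    then have "t * (norm (y - x))\<^sup>2 \<le> \<epsilon> * norm (y - x)"
      using mult_right_mono[of "t * norm (y - x)" \<epsilon> "norm (y - x)"]
      by (simp add: power2_eq_square mult.assoc)
    then show "\<psi> x + ereal (inner ?v (y - x) - \<epsilon> * norm (y - x)) \<le> \<psi> y"
      by (intro order_trans[OF _ ineq[of y]]) (simp add: psi_x)
  qed
  then have "?v \<in> regular_subdiff \<psi> x"
    by (simp add: regular_subdiff_def psi_x)
  then have "\<exists>xs vs. xs \<longlonglongrightarrow> x \<and> (\<lambda>n. \<psi> (xs n)) \<longlonglongrightarrow> \<psi> x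
      \<and> (\<forall>n. vs n \<in> regular_subdiff \<psi> (xs n)) \<and> vs \<longlonglongrightarrow> ?v"
    \<comment> \<open>Constant sequences exhibit a regular subgradient as a limiting one.\<close>
    by (intro exI[of _ "\<lambda>_. x"] exI[of _ "\<lambda>_. ?v"]) simp
  then show ?thesis by (simp add: limiting_subdiff_def psi_x)
qed

text \<open>The increment of step \<open>k\<close> controls the residual at the new iterate
  \<open>Suc k\<close>, so nothing is asked of \<open>G 0\<close>, and the minimum starts at
  1.\<close>

lemma summable_bound_rate:
  fixes G :: "nat \<Rightarrow> ereal" and s :: "nat \<Rightarrow> real"
  assumes nonneg: "\<And>k. 0 \<le> G k" "\<And>k. 0 \<le> s k" "0 \<le> C"
    and bound: "\<And>k. G (Suc k) \<le> ereal (C * s k)"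
    and sum: "\<And>T. (\<Sum>k<T. s k) \<le> S"
  shows "G \<longlonglongrightarrow> 0" "\<forall>T\<ge>1. Min (G ` {1..T}) \<le> ereal (C * S / real T)"
proof -
  have "(\<Sum>k\<le>n. s k) \<le> S" for n
    using sum[of "Suc n"] by (simp only: lessThan_Suc_atMost)
  then have "summable s"
    using nonneg(2) by (intro bounded_imp_summable[of s S])
  then have "(\<lambda>k. C * s k) \<longlonglongrightarrow> 0"
    using tendsto_mult_right_zero[OF summable_LIMSEQ_zero] by blast
  then have "(\<lambda>k. ereal (C * s k)) \<longlonglongrightarrow> 0" by (simp add: zero_ereal_def)
  then have "(\<lambda>k. G (Suc k)) \<longlonglongrightarrow> 0"
    by (rule tendsto_sandwich[rotated 3, where f = "\<lambda>_. 0"]) (auto simp: nonneg bound)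
  then show "G \<longlonglongrightarrow> 0" by (simp add: filterlim_sequentially_Suc)
  show "\<forall>T\<ge>1. Min (G ` {1..T}) \<le> ereal (C * S / real T)"
  proof (intro allI impI)
    fix T :: nat assume T: "T \<ge> 1"
    \<comment> \<open>Some term is at most the average of the first \<open>T\<close> terms.\<close>
    have "\<exists>k<T. real T * s k \<le> S"
    proof (rule ccontr)
      assume "\<not> ?thesis"
      then have "S / real T < s k" if "k < T" for k
        using that T by (auto simp: divide_less_eq mult.commute not_le)
      then have "(\<Sum>k<T. S / real T) < (\<Sum>k<T. s k)"
        using T by (intro sum_strict_mono) (auto simp: lessThan_empty_iff)
      with sum[of T] T show False by simp
    qed
    then obtain k where k: "k < T" "real T * s k \<le> S" by blast
    have "Min (G ` {1..T}) \<le> G (Suc k)" using k by (intro Min_le) auto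
    also have "\<dots> \<le> ereal (C * s k)" by (rule bound)
    also have "\<dots> \<le> ereal (C * S / real T)"
      using mult_left_mono[OF k(2) nonneg(3)] T by (simp add: field_simps)
    finally show "Min (G ` {1..T}) \<le> ereal (C * S / real T)" .
  qed
qed


section \<open>The iteration\<close>

text \<open>Here \<open>A\<close> and \<open>b\<close> are arbitrary maps, differentiable at the
  points of \<Theta> and bounded on it; the Bellman structure is used to establish these facts in
  the final instantiation.\<close>

locale projected_admm =
  fixes \<Theta> :: "'x::euclidean_space set"
    and \<phi> \<psi> :: "'x \<Rightarrow> ereal"
    and cw :: "real^'m"
    and A :: "'x \<Rightarrow> real^'m^'m"
    and b :: "'x \<Rightarrow> real^'m"
    and \<beta> \<eta>w \<eta>min \<kappa>A LA AB BB \<tau> Lbar \<alpha> :: real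
    and \<eta>\<theta> L :: "nat \<Rightarrow> real"
    and \<theta> :: "nat \<Rightarrow> 'x"
    and w \<nu> :: "nat \<Rightarrow> real^'m"
  assumes Theta: "convex \<Theta>"
    and psi: "\<psi> = (\<lambda>x. \<phi> x + indicator_ext \<Theta> x)"
    and psi_proper: "proper_fun \<psi>"
    and A_diff: "\<And>x. x \<in> \<Theta> \<Longrightarrow> A differentiable (at x)"
    and b_diff: "\<And>x. x \<in> \<Theta> \<Longrightarrow> b differentiable (at x)"
    and A_bounded: "\<exists>K. \<forall>x\<in>\<Theta>. spectral_norm (A x) \<le> K"
    and b_bounded: "\<exists>K. \<forall>x\<in>\<Theta>. norm (b x) \<le> K"
    and parameters: "\<beta> > 0" "\<eta>w > 0" "\<And>k. \<eta>\<theta> k > 0"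
    and algorithm: "proj_bellman_admm \<Theta> \<phi> cw A b \<beta> \<eta>w \<eta>\<theta> \<theta> w \<nu>"
    and A_inv: "\<And>x. x \<in> \<Theta> \<Longrightarrow> invertible (A x)"
               "\<And>x. x \<in> \<Theta> \<Longrightarrow> spectral_norm (matrix_inv (A x)) \<le> \<kappa>A"
    and A_lip: "\<And>x y. x \<in> \<Theta> \<Longrightarrow> y \<in> \<Theta> \<Longrightarrow> spectral_norm (A x - A y) \<le> LA * norm (x - y)"
    and DA_bounded: "\<exists>K. \<forall>x\<in>\<Theta>. \<forall>v. spectral_norm (frechet_derivative A (at x) v) \<le> K * norm v"
    and Db_bounded: "\<exists>K. \<forall>x\<in>\<Theta>. onorm (frechet_derivative b (at x)) \<le> K"
    and reduced_below:
      "bounded_below_on \<Theta> (\<lambda>x. \<phi> x + ereal (inner cw (matrix_inv (A x) *v b x)))"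
    and AB: "AB = 3 * \<kappa>A ^ 4 * LA\<^sup>2 * (norm cw)\<^sup>2"
    and BB: "BB = 3 * \<kappa>A\<^sup>2 / \<eta>w\<^sup>2"
    and tau: "BB / \<beta> < \<tau>" "\<tau> < 1 / (2 * \<eta>w) - BB / \<beta>"
    and eta_lower: "0 < \<eta>min" "\<And>k. \<eta>min \<le> \<eta>\<theta> k"
    and grad_lip: "\<And>k. (L k)-lipschitz_on (closed_segment (\<theta> k) (\<theta> (Suc k)))
                          (gradient (policy_coupling A b \<beta> (w k) (\<nu> k)))"
    and L_bound: "\<And>k. L k \<le> Lbar"
    and step: "\<alpha> > 0" "\<And>k. 1 / (2 * \<eta>\<theta> k) - L k / 2 - AB / \<beta> \<ge> \<alpha>"
begin

abbreviation R where "R \<equiv> bellman_residual A b"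
abbreviation h where "h k \<equiv> policy_coupling A b \<beta> (w k) (\<nu> k)"
abbreviation d\<theta> where "d\<theta> k \<equiv> \<theta> (Suc k) - \<theta> k"
abbreviation dw where "dw k \<equiv> w (Suc k) - w k"
abbreviation d\<nu> where "d\<nu> k \<equiv> \<nu> (Suc k) - \<nu> k"

text \<open>Real counterparts of extended-real quantities. They are faithful because \<phi> is
  finite along the iterates (\<open>phi_finite\<close>), and they allow subtraction in the
  estimates.\<close>

definition p where "p k = real_of_ereal (\<phi> (\<theta> k))"

definition lag where
  "lag k = p k + inner cw (w k) + inner (\<nu> k) (R (w k) (\<theta> k)) + \<beta> / 2 * (norm (R (w k) (\<theta> k)))\<^sup>2"

text \<open>At index 0 truncated subtraction makes the correction vanish; the descent estimates
  start at index 1, where it is a genuine increment.\<close>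

definition lyap where "lyap k = lag k + \<tau> * (norm (w k - w (k - 1)))\<^sup>2"

section \<open>Feasibility and finiteness of the iterates\<close>

lemma theta_start: "\<phi> (\<theta> 0) + indicator_ext \<Theta> (\<theta> 0) < \<infinity>"
  using algorithm by (simp add: proj_bellman_admm_def dom_ext_def)

lemma theta_in: "\<theta> k \<in> \<Theta>"
proof (cases k)
  case 0
  then show ?thesis using theta_start by (auto simp: indicator_ext_def split: if_splits)
next
  case (Suc j)
  then show ?thesis
    using algorithm by (auto simp: proj_bellman_admm_def is_arg_min_def)
qed

lemma theta_step:
  assumes "y \<in> \<Theta>"
  shows "\<phi> (\<theta> (Suc k)) + ereal (inner (gradient (h k) (\<theta> k)) (d\<theta> k) + 1 / (2 * \<eta>\<theta> k) * (norm (d\<theta> k))\<^sup>2)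
      \<le> \<phi> y + ereal (inner (gradient (h k) (\<theta> k)) (y - \<theta> k) + 1 / (2 * \<eta>\<theta> k) * (norm (y - \<theta> k))\<^sup>2)"
  using algorithm assms unfolding proj_bellman_admm_def is_arg_min_def by (auto simp: not_less)

lemma phi_finite: "\<bar>\<phi> (\<theta> k)\<bar> \<noteq> \<infinity>"
proof -
  have not_minf: "\<phi> x \<noteq> - \<infinity>" if "x \<in> \<Theta>" for x
    using psi_proper that unfolding proper_fun_def psi by (metis add.right_neutral indicator_ext_def)
  show ?thesis
  proof (induction k)
    case 0
    then show ?case
      using theta_start not_minf[OF theta_in[of 0]] theta_in[of 0]
      by (cases "\<phi> (\<theta> 0)") (auto simp: indicator_ext_def)
  next
    case (Suc k)
    then show ?case
      using theta_step[OF theta_in[of k], of k] not_minf[OF theta_in[of "Suc k"]]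
      by (cases "\<phi> (\<theta> (Suc k))"; cases "\<phi> (\<theta> k)") auto
  qed
qed

lemma phi_eq: "\<phi> (\<theta> k) = ereal (p k)"
  unfolding p_def using phi_finite[of k] by (simp add: ereal_real)

lemma lyapunov_eq: "lyapunov \<phi> cw A b \<beta> \<tau> \<theta> w \<nu> k = ereal (lyap k)"
  by (simp add: lyapunov_def aug_lagrangian_def phi_eq lyap_def lag_def add.assoc)

lemma dual_step: "d\<nu> k = \<beta> *\<^sub>R R (w (Suc k)) (\<theta> (Suc k))"
  using algorithm by (simp add: proj_bellman_admm_def bellman_residual_def)

section \<open>Policy gradients of the residual and of the coupling\<close>

lemma has_derivative_R:
  assumes "x \<in> \<Theta>"
  shows "(R u has_derivative
    (\<lambda>v. frechet_derivative A (at x) v *v u - frechet_derivative b (at x) v)) (at x)"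
proof -
  have "linear (\<lambda>B :: real^'m^'m. B *v u)"
    by (auto intro!: linearI simp: matrix_vector_mult_add_rdistrib scaleR_matrix_vector_assoc)
  then have "((\<lambda>y. A y *v u) has_derivative (\<lambda>v. frechet_derivative A (at x) v *v u)) (at x)"
    using A_diff[OF assms]
    by (intro bounded_linear.has_derivative[of "\<lambda>B. B *v u"])
       (auto simp: linear_conv_bounded_linear frechet_derivative_works[symmetric])
  then show ?thesis
    unfolding bellman_residual_def[abs_def] using b_diff[OF assms]
    by (intro has_derivative_diff) (auto simp: frechet_derivative_works[symmetric])
qed

lemma frechet_derivative_R:
  assumes "x \<in> \<Theta>"
  shows "frechet_derivative (R u) (at x)
    = (\<lambda>v. frechet_derivative A (at x) v *v u - frechet_derivative b (at x) v)"
  using frechet_derivative_at[OF has_derivative_R[OF assms]] by simp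

lemma linear_frechet_derivative_R:
  assumes "x \<in> \<Theta>"
  shows "linear (frechet_derivative (R u) (at x))"
  using has_derivative_R[OF assms] unfolding frechet_derivative_R[OF assms]
  by (rule has_derivative_linear)

text \<open>Differentiating the penalty merely shifts the multiplier by \<beta> times the residual,
  so the gradient has the form of the KKT term at a shifted multiplier.\<close>

lemma gderiv_policy_coupling:
  assumes x: "x \<in> \<Theta>"
  shows "GDERIV (policy_coupling A b \<beta> u \<mu>) x :>
    adjoint (frechet_derivative (R u) (at x)) (\<mu> + \<beta> *\<^sub>R R u x)"
proof -
  let ?D = "frechet_derivative (R u) (at x)"
  have R: "(R u has_derivative ?D) (at x)"
    using has_derivative_R[OF x] by (simp add: frechet_derivative_R[OF x])
  have "((\<lambda>y. inner \<mu> (R u y) + \<beta> / 2 * (inner (R u y) (R u y))) has_derivative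
      (\<lambda>v. inner \<mu> (?D v) + \<beta> / 2 * (inner (R u x) (?D v) + inner (?D v) (R u x)))) (at x)"
    by (intro has_derivative_add has_derivative_inner_right has_derivative_mult_right
        has_derivative_inner R)
  moreover have "inner \<mu> (?D v) + \<beta> / 2 * (inner (R u x) (?D v) + inner (?D v) (R u x))
      = inner v (adjoint ?D (\<mu> + \<beta> *\<^sub>R R u x))" for v
    unfolding adjoint_works[OF linear_frechet_derivative_R[OF x]]
    by (simp add: inner_add_right inner_commute)
  ultimately show ?thesis
    by (simp add: gderiv_def policy_coupling_def[abs_def] power2_norm_eq_inner)
qed

lemmas gradient_policy_coupling = gradient_eqI[OF gderiv_policy_coupling]

section \<open>Optimality of the value step and the dual increment\<close>

lemma w_step:
  "inner cw (w (Suc k)) + policy_coupling A b \<beta> (w (Suc k)) (\<nu> k) (\<theta> (Suc k))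
      + 1 / (2 * \<eta>w) * (norm (dw k))\<^sup>2
    \<le> inner cw u + policy_coupling A b \<beta> u (\<nu> k) (\<theta> (Suc k)) + 1 / (2 * \<eta>w) * (norm (u - w k))\<^sup>2"
proof -
  have "aug_lagrangian \<phi> cw A b \<beta> (\<theta> (Suc k)) (w (Suc k)) (\<nu> k)
        + ereal (1 / (2 * \<eta>w) * (norm (dw k))\<^sup>2)
      \<le> aug_lagrangian \<phi> cw A b \<beta> (\<theta> (Suc k)) u (\<nu> k) + ereal (1 / (2 * \<eta>w) * (norm (u - w k))\<^sup>2)"
    using algorithm unfolding proj_bellman_admm_def is_arg_min_def by (auto simp: not_less)
  then show ?thesis
    by (simp add: aug_lagrangian_def policy_coupling_def phi_eq)
qed

text \<open>The first-order condition of the quadratic value problem. The multiplier update absorbs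
  the penalty gradient exactly, and only the proximal term remains.\<close>

lemma w_optimality:
  "transpose (A (\<theta> (Suc k))) *v \<nu> (Suc k) = - (cw + (1 / \<eta>w) *\<^sub>R dw k)"
proof -
  let ?A = "A (\<theta> (Suc k))" and ?b = "b (\<theta> (Suc k))"
  let ?f = "\<lambda>u. inner cw u + inner (\<nu> k) (?A *v u - ?b)
    + \<beta> / 2 * inner (?A *v u - ?b) (?A *v u - ?b) + 1 / (2 * \<eta>w) * inner (u - w k) (u - w k)"
  let ?F = "?A *v w (Suc k) - ?b"
  let ?f' = "\<lambda>v. inner cw v + inner (\<nu> k) (?A *v v - 0)
    + \<beta> / 2 * (inner ?F (?A *v v - 0) + inner (?A *v v - 0) ?F)
    + 1 / (2 * \<eta>w) * (inner (dw k) (v - 0) + inner (v - 0) (dw k))"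
  have A: "((\<lambda>u. ?A *v u) has_derivative (\<lambda>v. ?A *v v)) (at x)" for x
    by (intro bounded_linear_imp_has_derivative) simp
  have "(?f has_derivative ?f') (at (w (Suc k)))"
    by (intro has_derivative_add has_derivative_inner_right has_derivative_mult_right
        has_derivative_inner has_derivative_diff has_derivative_const has_derivative_ident A)
  moreover have "?f (w (Suc k)) \<le> ?f u" for u
    using w_step[of k u] by (simp add: policy_coupling_def bellman_residual_def power2_norm_eq_inner)
  ultimately have zero: "?f' = (\<lambda>v. 0)"
    by (intro has_derivative_local_min[of ?f]) auto
  let ?v = "transpose ?A *v \<nu> (Suc k) + (cw + (1 / \<eta>w) *\<^sub>R dw k)"
  have nu: "\<nu> (Suc k) = \<nu> k + \<beta> *\<^sub>R ?F"
    using dual_step[of k] by (simp add: bellman_residual_def algebra_simps)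
  have f': "inner ?v v = ?f' v" for v
    unfolding nu
    by (simp add: inner_add_left dot_lmul_matrix inner_commute[of v] inner_commute[of "?A *v v"])
  \<comment> \<open>\<open>?v\<close> represents the derivative functional, which vanishes; it is
    evaluated at \<open>?v\<close> itself.\<close>
  have "inner ?v ?v = 0" by (rule trans[OF f' fun_cong[OF zero]])
  then have "?v = 0" by simp
  then show ?thesis by (simp only: eq_neg_iff_add_eq_0)
qed

lemma dual_eq:
  "\<nu> (Suc k) = - (transpose (matrix_inv (A (\<theta> (Suc k)))) *v (cw + (1 / \<eta>w) *\<^sub>R dw k))"
proof -
  let ?A = "A (\<theta> (Suc k))"
  have "\<nu> (Suc k) = transpose (?A ** matrix_inv ?A) *v \<nu> (Suc k)"
    by (simp only: matrix_inv_left_right A_inv(1)[OF theta_in] transpose_mat matrix_vector_mul_lid)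
  also have "\<dots> = transpose (matrix_inv ?A) *v (transpose ?A *v \<nu> (Suc k))"
    by (simp only: matrix_transpose_mul matrix_vector_mul_assoc)
  also have "\<dots> = - (transpose (matrix_inv ?A) *v (cw + (1 / \<eta>w) *\<^sub>R dw k))"
    by (simp only: w_optimality linear_neg[OF matrix_vector_mul_linear])
  finally show ?thesis .
qed

abbreviation J where "J k \<equiv> matrix_inv (A (\<theta> k))"

lemma norm_J_transpose_le: "norm (transpose (J k) *v u) \<le> \<kappa>A * norm u"
  by (rule order_trans[OF norm_transpose_vector_le_spectral_norm])
     (intro mult_right_mono A_inv theta_in norm_ge_zero)

lemma kappa_nonneg: "0 \<le> \<kappa>A"
  using A_inv(2)[OF theta_in[of 0]] spectral_norm_nonneg order_trans by blast

text \<open>Subtracting \<open>dual_eq\<close> at consecutive iterates leaves three terms: the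
  change of the inverse applied to \<open>cw\<close>, and two scaled value increments. Squaring a
  sum of three terms yields the factor 3 in \<open>AB\<close> and \<open>BB\<close>. The index
  starts at \<open>Suc k\<close> because the initial multiplier is arbitrary and need not satisfy
  \<open>dual_eq\<close>.\<close>

lemma dual_difference_bound:
  "(norm (d\<nu> (Suc k)))\<^sup>2 \<le> AB * (norm (d\<theta> (Suc k)))\<^sup>2 + BB * ((norm (dw (Suc k)))\<^sup>2 + (norm (dw k))\<^sup>2)"
proof -
  let ?J' = "J (Suc (Suc k))" and ?J = "J (Suc k)" and ?q = "\<kappa>A / \<eta>w"
  let ?a = "\<kappa>A * (LA * norm (d\<theta> (Suc k))) * \<kappa>A * norm cw"
  have inv: "invertible (A (\<theta> j))" for j by (rule A_inv(1)[OF theta_in])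
  have lip: "spectral_norm (A (\<theta> (Suc k)) - A (\<theta> (Suc (Suc k)))) \<le> LA * norm (d\<theta> (Suc k))"
    using A_lip[OF theta_in theta_in, of "Suc k" "Suc (Suc k)"] by (simp add: norm_minus_commute)
  have "spectral_norm (?J' - ?J) \<le> \<kappa>A * (LA * norm (d\<theta> (Suc k))) * \<kappa>A"
    unfolding matrix_inv_diff[OF inv inv]
    by (rule order_trans[OF spectral_norm_matrix_mult_le], rule mult_mono,
        rule order_trans[OF spectral_norm_matrix_mult_le], rule mult_mono)
       (use lip A_inv(2)[OF theta_in] kappa_nonneg spectral_norm_nonneg order_trans[OF spectral_norm_nonneg lip] in auto)
  then have a: "norm (transpose (?J' - ?J) *v cw) \<le> ?a"
    by (intro order_trans[OF norm_transpose_vector_le_spectral_norm] mult_right_mono) auto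
  have bnd: "norm ((1 / \<eta>w) *\<^sub>R (transpose (J j) *v u)) \<le> ?q * norm u" for j u
    using norm_J_transpose_le[of j u] parameters by (simp add: divide_right_mono)
  have "d\<nu> (Suc k) = - (transpose (?J' - ?J) *v cw)
      - (1 / \<eta>w) *\<^sub>R (transpose ?J' *v dw (Suc k)) + (1 / \<eta>w) *\<^sub>R (transpose ?J *v dw k)"
    unfolding dual_eq
    by (simp only: transpose_diff matrix_vector_mult_diff_rdistrib matrix_vector_right_distrib
        matrix_vector_mult_scaleR)
       (simp only: diff_conv_add_uminus minus_add_distrib minus_minus ac_simps)
  moreover have "norm (- x - y + z) \<le> norm x + norm y + norm z" for x y z :: "real^'m"
    using norm_triangle_ineq[of "- x - y" z] norm_triangle_ineq4[of "- x" y] by simp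
  ultimately have "norm (d\<nu> (Suc k)) \<le> norm (transpose (?J' - ?J) *v cw)
      + norm ((1 / \<eta>w) *\<^sub>R (transpose ?J' *v dw (Suc k))) + norm ((1 / \<eta>w) *\<^sub>R (transpose ?J *v dw k))"
    by metis
  also have "\<dots> \<le> ?a + ?q * norm (dw (Suc k)) + ?q * norm (dw k)"
    by (intro add_mono a bnd)
  finally have "(norm (d\<nu> (Suc k)))\<^sup>2 \<le> (?a + ?q * norm (dw (Suc k)) + ?q * norm (dw k))\<^sup>2"
    by (intro power_mono) auto
  also have "\<dots> \<le> 3 * (?a\<^sup>2 + (?q * norm (dw (Suc k)))\<^sup>2 + (?q * norm (dw k))\<^sup>2)"
  proof -
    have "(x + y + z)\<^sup>2 \<le> 3 * (x\<^sup>2 + y\<^sup>2 + z\<^sup>2)" for x y z :: real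
      using zero_le_power2[of "x - y"] zero_le_power2[of "y - z"] zero_le_power2[of "x - z"]
      unfolding power2_eq_square by (simp add: algebra_simps)
    then show ?thesis .
  qed
  also have "\<dots> = AB * (norm (d\<theta> (Suc k)))\<^sup>2 + BB * ((norm (dw (Suc k)))\<^sup>2 + (norm (dw k))\<^sup>2)"
    unfolding AB BB by (simp add: power_mult_distrib power_divide distrib_left) (simp add: power_def)
  finally show ?thesis .
qed

section \<open>Descent of the augmented Lagrangian and of the Lyapunov function\<close>

lemma lag_eq: "lag k = p k + inner cw (w k) + h k (\<theta> k)"
  by (simp add: lag_def policy_coupling_def)

text \<open>The policy and value steps lower the Lagrangian by comparison with the old iterate; the
  dual step raises it by the squared dual increment over \<beta>.\<close>

lemma lag_step:
  "lag (Suc k) \<le> lag k - (1 / (2 * \<eta>\<theta> k) - L k / 2) * (norm (d\<theta> k))\<^sup>2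
     - 1 / (2 * \<eta>w) * (norm (dw k))\<^sup>2 + (norm (d\<nu> k))\<^sup>2 / \<beta>"
proof -
  have "h k (\<theta> (Suc k))
      \<le> h k (\<theta> k) + inner (gradient (h k) (\<theta> k)) (d\<theta> k) + L k / 2 * (norm (d\<theta> k))\<^sup>2"
  proof (rule lipschitz_gradient_descent[OF _ grad_lip])
    fix z assume "z \<in> closed_segment (\<theta> k) (\<theta> (Suc k))"
    then have "z \<in> \<Theta>"
      using closed_segment_subset[OF theta_in theta_in Theta] by blast
    then show "GDERIV (h k) z :> gradient (h k) z"
      using gderiv_policy_coupling gradient_policy_coupling by metis
  qed
  moreover have "p (Suc k) + inner (gradient (h k) (\<theta> k)) (d\<theta> k)
      + 1 / (2 * \<eta>\<theta> k) * (norm (d\<theta> k))\<^sup>2 \<le> p k"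
    using theta_step[OF theta_in[of k], of k] by (simp add: phi_eq)
  moreover note w_step[of k "w k"]
  \<comment> \<open>The new residual is the dual increment divided by \<beta>, so the effect of
    changing only the multiplier is explicit.\<close>
  moreover have "h (Suc k) (\<theta> (Suc k))
      = policy_coupling A b \<beta> (w (Suc k)) (\<nu> k) (\<theta> (Suc k)) + (norm (d\<nu> k))\<^sup>2 / \<beta>"
  proof -
    have "inner (d\<nu> k) (R (w (Suc k)) (\<theta> (Suc k))) = (norm (d\<nu> k))\<^sup>2 / \<beta>"
      using parameters
      by (simp add: dual_step power_mult_distrib power2_eq_square[of \<beta>] flip: power2_norm_eq_inner)
    then show ?thesis by (simp add: policy_coupling_def inner_diff_left)
  qed
  ultimately show ?thesis
    unfolding lag_eq by (simp add: algebra_simps)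
qed

text \<open>The correction in \<open>lyap (Suc k)\<close> pays for the older value increment in the
  dual bound, while the new correction is charged to the proximal term. The remaining coefficients
  are those that \<open>step\<close> and \<open>tau\<close> make positive.\<close>

lemma lyap_step:
  "lyap (Suc (Suc k)) \<le> lyap (Suc k) - \<alpha> * (norm (d\<theta> (Suc k)))\<^sup>2
     - (1 / (2 * \<eta>w) - BB / \<beta> - \<tau>) * (norm (dw (Suc k)))\<^sup>2 - (\<tau> - BB / \<beta>) * (norm (dw k))\<^sup>2"
proof -
  let ?x = "(norm (d\<theta> (Suc k)))\<^sup>2" and ?c = "1 / (2 * \<eta>\<theta> (Suc k)) - L (Suc k) / 2"
  have "(norm (d\<nu> (Suc k)))\<^sup>2 / \<beta>
      \<le> AB / \<beta> * ?x + BB / \<beta> * (norm (dw (Suc k)))\<^sup>2 + BB / \<beta> * (norm (dw k))\<^sup>2"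
    using divide_right_mono[OF dual_difference_bound[of k], of \<beta>] parameters
    by (simp add: add_divide_distrib distrib_left)
  moreover have "\<alpha> * ?x \<le> (?c - AB / \<beta>) * ?x"
    using step(2)[of "Suc k"] by (intro mult_right_mono) auto
  ultimately show ?thesis
    using lag_step[of "Suc k"] unfolding lyap_def
    by (simp add: left_diff_distrib)
qed

section \<open>Lower bound and summability of the squared increments\<close>

lemma lyap_lower_bound: "\<exists>m. \<forall>k. m \<le> lyap (Suc k)"
proof -
  obtain m where m: "\<And>x. x \<in> \<Theta> \<Longrightarrow> ereal m \<le> \<phi> x + ereal (inner cw (matrix_inv (A x) *v b x))"
    using reduced_below unfolding bounded_below_on_def by blast
  \<comment> \<open>\<open>\<nu>\<close> differs from the exact multiplier of the reduced problem by a term of size \<open>dw k\<close>, so \<open>lag\<close> is the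
    reduced objective plus a cross term of \<open>dw k\<close> with the residual.\<close>
  have "m \<le> lyap (Suc k)" for k
  proof -
    let ?J = "J (Suc k)" and ?b = "b (\<theta> (Suc k))" and ?R = "R (w (Suc k)) (\<theta> (Suc k))"
    let ?X = "\<kappa>A / \<eta>w * norm (dw k)" and ?Y = "\<beta> * norm ?R"
    have "?J *v (?b + ?R) = (?J ** A (\<theta> (Suc k))) *v w (Suc k)"
      by (simp add: bellman_residual_def matrix_vector_mul_assoc)
    then have "w (Suc k) = ?J *v ?b + ?J *v ?R"
      by (simp add: matrix_inv_left_right A_inv(1)[OF theta_in] matrix_vector_right_distrib)
    then have cw_w: "inner cw (w (Suc k)) = inner cw (?J *v ?b) + inner (transpose ?J *v cw) ?R"
      by (metis inner_add_right dot_lmul_matrix transpose_matrix_vector)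
    have nu_R: "inner (\<nu> (Suc k)) ?R
        = - inner (transpose ?J *v cw) ?R - 1 / \<eta>w * inner (transpose ?J *v dw k) ?R"
      unfolding dual_eq
      by (simp add: matrix_vector_right_distrib matrix_vector_mult_scaleR inner_diff_left inner_add_left
          del: transpose_matrix_vector)
    have "inner (transpose ?J *v dw k) ?R \<le> \<kappa>A * norm (dw k) * norm ?R"
      by (intro order_trans[OF norm_cauchy_schwarz] mult_right_mono norm_J_transpose_le norm_ge_zero)
    then have cross: "1 / \<eta>w * inner (transpose ?J *v dw k) ?R \<le> ?X * ?Y / \<beta>"
      using mult_left_mono[of _ _ "1 / \<eta>w"] parameters by fastforce
    \<comment> \<open>A Young inequality with weights fitted to the two absorbing terms: after
      division by \<beta>, \<open>3 * ?X\<^sup>2\<close> becomes the \<open>BB\<close> term, which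
      lies below the \<tau> correction, and \<open>?Y\<^sup>2 / 2\<close> becomes the
      penalty.\<close>
    have "0 \<le> 5 * ?X\<^sup>2 + (?X - ?Y)\<^sup>2" by simp
    then have "?X * ?Y \<le> 3 * ?X\<^sup>2 + ?Y\<^sup>2 / 2"
      by (simp add: power2_diff)
    then have "?X * ?Y / \<beta> \<le> (3 * ?X\<^sup>2 + ?Y\<^sup>2 / 2) / \<beta>"
      using parameters by (intro divide_right_mono) auto
    also have "\<dots> = BB / \<beta> * (norm (dw k))\<^sup>2 + \<beta> / 2 * (norm ?R)\<^sup>2"
      unfolding BB using parameters by (simp add: field_simps power2_eq_square)
    also have "\<dots> \<le> \<tau> * (norm (dw k))\<^sup>2 + \<beta> / 2 * (norm ?R)\<^sup>2"
      using tau by (intro add_right_mono mult_right_mono) auto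
    finally show ?thesis
      using m[OF theta_in[of "Suc k"]] cross cw_w nu_R
      by (simp add: lyap_def lag_def phi_eq)
  qed
  then show ?thesis by blast
qed

definition increment_sq where "increment_sq k = (norm (d\<theta> k))\<^sup>2 + (norm (dw k))\<^sup>2 + (norm (d\<nu> k))\<^sup>2"

lemma increment_sq_nonneg: "0 \<le> increment_sq k"
  by (simp add: increment_sq_def)

text \<open>Each squared increment is at most a constant times the Lyapunov drop; the drops
  telescope, and the lower bound caps their sum.\<close>

lemma increment_sq_sum_bounded: "\<exists>S. \<forall>T. (\<Sum>k<T. increment_sq k) \<le> S"
proof -
  define c1 where "c1 = 1 / (2 * \<eta>w) - BB / \<beta> - \<tau>"
  define c2 where "c2 = \<tau> - BB / \<beta>"
  have pos: "c1 > 0" "c2 > 0" using tau by (auto simp: c1_def c2_def)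
  have nonneg: "0 \<le> AB" "0 \<le> BB" by (auto simp: AB BB)
  \<comment> \<open>One summand for each ratio of a weight in \<open>increment_sq\<close> to the
    matching coefficient in \<open>lyap_step\<close>. The weights \<open>AB\<close> and
    \<open>BB\<close> come from the dual increment, each added 1 from a primal increment
    itself.\<close>
  define C where "C = (AB + 1) / \<alpha> + (BB + 1) / c1 + BB / c2"
  have quot: "0 \<le> (AB + 1) / \<alpha>" "0 \<le> (BB + 1) / c1" "0 \<le> BB / c2"
    using nonneg pos step(1) by auto
  then have "(AB + 1) / \<alpha> \<le> C" "(BB + 1) / c1 \<le> C" "BB / c2 \<le> C" "0 \<le> C"
    by (auto simp: C_def)
  then have C: "AB + 1 \<le> C * \<alpha>" "BB + 1 \<le> C * c1" "BB \<le> C * c2" "0 \<le> C"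
    using pos step(1) by (auto simp: pos_divide_le_eq)
  have bound: "increment_sq (Suc k) \<le> C * (lyap (Suc k) - lyap (Suc (Suc k)))" for k
  proof -
    have "increment_sq (Suc k) \<le> (AB + 1) * (norm (d\<theta> (Suc k)))\<^sup>2 + (BB + 1) * (norm (dw (Suc k)))\<^sup>2
        + BB * (norm (dw k))\<^sup>2"
      using dual_difference_bound[of k] by (simp add: increment_sq_def algebra_simps)
    also have "\<dots> \<le> C * \<alpha> * (norm (d\<theta> (Suc k)))\<^sup>2 + C * c1 * (norm (dw (Suc k)))\<^sup>2
        + C * c2 * (norm (dw k))\<^sup>2"
      by (intro add_mono mult_right_mono C) auto
    also have "\<dots> = C * (\<alpha> * (norm (d\<theta> (Suc k)))\<^sup>2 + c1 * (norm (dw (Suc k)))\<^sup>2 + c2 * (norm (dw k))\<^sup>2)"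
      by (simp add: algebra_simps)
    also have "\<dots> \<le> C * (lyap (Suc k) - lyap (Suc (Suc k)))"
      using lyap_step[of k] C(4) by (intro mult_left_mono) (auto simp: c1_def c2_def)
    finally show ?thesis .
  qed
  obtain m where m: "\<And>k. m \<le> lyap (Suc k)" using lyap_lower_bound by blast
  \<comment> \<open>The first increment is kept apart, since the dual bound only starts at index
    1.\<close>
  have "(\<Sum>k<T. increment_sq k) \<le> increment_sq 0 + C * (lyap (Suc 0) - m)" for T
  proof -
    have "(\<Sum>k<T. increment_sq (Suc k)) \<le> (\<Sum>k<T. C * (lyap (Suc k) - lyap (Suc (Suc k))))"
      by (intro sum_mono bound)
    also have "\<dots> = C * (lyap (Suc 0) - lyap (Suc T))"
      by (induction T) (auto simp: algebra_simps)
    also have "\<dots> \<le> C * (lyap (Suc 0) - m)"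
      using m C(4) by (intro mult_left_mono) auto
    finally have "(\<Sum>k<Suc T. increment_sq k) \<le> increment_sq 0 + C * (lyap (Suc 0) - m)"
      by (simp only: sum.lessThan_Suc_shift)
    then show ?thesis using increment_sq_nonneg[of T] by simp
  qed
  then show ?thesis by blast
qed

section \<open>Bounded iterates, and the KKT residual bounded by the last increments\<close>

lemma increments_bounded: "\<exists>B\<ge>0. \<forall>k. norm (dw k) \<le> B \<and> norm (d\<nu> k) \<le> B"
proof -
  obtain S where S: "\<And>T. (\<Sum>k<T. increment_sq k) \<le> S" using increment_sq_sum_bounded by blast
  have le: "increment_sq k \<le> S" for k
    using S[of "Suc k"] sum_nonneg[of "{..<k}" increment_sq] increment_sq_nonneg by auto
  have "norm (dw k) \<le> sqrt S \<and> norm (d\<nu> k) \<le> sqrt S" for k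
  proof -
    have "(norm (dw k))\<^sup>2 \<le> increment_sq k" "(norm (d\<nu> k))\<^sup>2 \<le> increment_sq k" by (simp_all add: increment_sq_def)
    then show ?thesis using le[of k] by (auto intro!: real_le_rsqrt)
  qed
  moreover have "0 \<le> sqrt S" using S[of 0] by simp
  ultimately show ?thesis by blast
qed

text \<open>The multipliers are bounded by \<open>dual_eq\<close>; the values by solving the Bellman
  equation with right-hand side perturbed by the residual, which is a bounded dual increment over
  \<beta>. Index 0 of the multiplier is left out because \<open>dual_eq\<close> does not reach
  it.\<close>

lemma iterates_bounded: "\<exists>B\<ge>0. \<forall>k. norm (w k) \<le> B \<and> norm (\<nu> (Suc k)) \<le> B"
proof -
  obtain B where B: "0 \<le> B" "\<And>k. norm (dw k) \<le> B" "\<And>k. norm (d\<nu> k) \<le> B"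
    using increments_bounded by blast
  obtain K where K: "\<And>x. x \<in> \<Theta> \<Longrightarrow> norm (b x) \<le> K" using b_bounded by blast
  have nu: "norm (\<nu> (Suc k)) \<le> \<kappa>A * (norm cw + B / \<eta>w)" for k
  proof -
    have "norm (cw + (1 / \<eta>w) *\<^sub>R dw k) \<le> norm cw + B / \<eta>w"
      using B(2)[of k] parameters
      by (intro order_trans[OF norm_triangle_ineq] add_left_mono) (simp add: divide_right_mono)
    then show ?thesis
      unfolding dual_eq norm_minus_cancel using kappa_nonneg
      by (intro order_trans[OF norm_J_transpose_le] mult_left_mono)
  qed
  have w: "norm (w (Suc k)) \<le> \<kappa>A * (K + B / \<beta>)" for k
  proof -
    let ?R = "R (w (Suc k)) (\<theta> (Suc k))"
    have "w (Suc k) = (J (Suc k) ** A (\<theta> (Suc k))) *v w (Suc k)"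
      by (simp add: matrix_inv_left_right A_inv(1)[OF theta_in])
    also have "\<dots> = J (Suc k) *v (b (\<theta> (Suc k)) + ?R)"
      by (simp add: bellman_residual_def matrix_vector_mul_assoc)
    finally have "norm (w (Suc k)) \<le> spectral_norm (J (Suc k)) * norm (b (\<theta> (Suc k)) + ?R)"
      using norm_matrix_vector_le_spectral_norm by metis
    also have "norm ?R \<le> B / \<beta>"
      using B(3)[of k] parameters by (simp add: dual_step pos_le_divide_eq mult.commute)
    then have "norm (b (\<theta> (Suc k)) + ?R) \<le> K + B / \<beta>"
      by (intro order_trans[OF norm_triangle_ineq] add_mono K theta_in)
    then have "spectral_norm (J (Suc k)) * norm (b (\<theta> (Suc k)) + ?R) \<le> \<kappa>A * (K + B / \<beta>)"
      using kappa_nonneg A_inv(2)[OF theta_in] by (intro mult_mono) auto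
    finally show ?thesis .
  qed
  have "norm (w k) \<le> \<bar>\<kappa>A * (norm cw + B / \<eta>w)\<bar> + \<bar>\<kappa>A * (K + B / \<beta>)\<bar> + norm (w 0)" for k
  proof (cases k)
    case (Suc j)
    then show ?thesis unfolding Suc using w[of j] norm_ge_zero[of "w 0"] by linarith
  qed simp
  moreover have "norm (\<nu> (Suc k)) \<le> \<bar>\<kappa>A * (norm cw + B / \<eta>w)\<bar> + \<bar>\<kappa>A * (K + B / \<beta>)\<bar> + norm (w 0)" for k
    using nu[of k] norm_ge_zero[of "w 0"] by linarith
  ultimately show ?thesis
    by (intro exI[of _ "\<bar>\<kappa>A * (norm cw + B / \<eta>w)\<bar> + \<bar>\<kappa>A * (K + B / \<beta>)\<bar> + norm (w 0)"]) auto
qed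

text \<open>\<open>D\<^sub>\<theta>A\<close> is only bounded, not continuous with a modulus, so all gradients are compared at
  \<open>\<theta> (Suc k)\<close>; the passage from \<open>\<theta> k\<close> is left to the segment Lipschitz hypothesis.\<close>

lemma policy_gradient_difference_bound:
  "\<exists>C\<ge>0. \<forall>k. norm (adjoint (frechet_derivative (R (w (Suc k))) (at (\<theta> (Suc k)))) (\<nu> (Suc k))
      - gradient (h k) (\<theta> (Suc k))) \<le> C * norm (dw k)"
proof -
  obtain B where B: "0 \<le> B" "\<And>k. norm (w k) \<le> B" "\<And>k. norm (\<nu> (Suc k)) \<le> B"
    using iterates_bounded by blast
  obtain KA where "\<And>x. x \<in> \<Theta> \<Longrightarrow> spectral_norm (A x) \<le> KA" using A_bounded by blast
  then have KA: "norm (A (\<theta> k) *v v) \<le> KA * norm v" for k v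
    using theta_in[of k]
    by (intro order_trans[OF norm_matrix_vector_le_spectral_norm] mult_right_mono) auto
  have KA0: "0 \<le> KA"
    using \<open>\<And>x. x \<in> \<Theta> \<Longrightarrow> spectral_norm (A x) \<le> KA\<close>[OF theta_in[of 0]] spectral_norm_nonneg order_trans
    by blast
  obtain K1 where K1: "\<And>x v. x \<in> \<Theta> \<Longrightarrow> spectral_norm (frechet_derivative A (at x) v) \<le> K1 * norm v"
    using DA_bounded by blast
  obtain K2 where K2: "\<And>x. x \<in> \<Theta> \<Longrightarrow> onorm (frechet_derivative b (at x)) \<le> K2"
    using Db_bounded by blast
  \<comment> \<open>The first summand bounds the change of \<open>w\<close> inside the derivative,
    paired with the multiplier; the second bounds the change of the effective multiplier.\<close>
  define C where "C = B * \<bar>K1\<bar> + \<beta> * KA * (\<bar>K1\<bar> * B + \<bar>K2\<bar>)"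
  have "C \<ge> 0" using B(1) KA0 parameters by (auto simp: C_def)
  moreover have "norm (adjoint (frechet_derivative (R (w (Suc k))) (at (\<theta> (Suc k)))) (\<nu> (Suc k))
      - gradient (h k) (\<theta> (Suc k))) \<le> C * norm (dw k)" (is "norm ?e \<le> _") for k
  proof -
    let ?x = "\<theta> (Suc k)" and ?\<nu> = "\<nu> (Suc k)"
    let ?DA = "\<lambda>v. frechet_derivative A (at ?x) v" and ?Db = "\<lambda>v. frechet_derivative b (at ?x) v"
    have x: "?x \<in> \<Theta>" by (rule theta_in)
    have DA: "norm (?DA v *v u) \<le> \<bar>K1\<bar> * norm v * norm u" for v u
      by (rule order_trans[OF norm_matrix_vector_le_spectral_norm], rule mult_right_mono,
          rule order_trans[OF K1[OF x]], rule mult_right_mono) auto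
    have "bounded_linear (frechet_derivative b (at ?x))"
      using b_diff[OF x] frechet_derivative_works has_derivative_bounded_linear by blast
    then have Db: "norm (?Db v) \<le> \<bar>K2\<bar> * norm v" for v
      by (intro order_trans[OF onorm] mult_right_mono order_trans[OF K2[OF x]]) auto
    \<comment> \<open>\<open>h k\<close> still uses the old value vector, so its effective
      multiplier at the new policy misses \<open>\<nu> (Suc k)\<close> by \<beta> times the image of
      the value increment.\<close>
    have mult: "\<nu> k + \<beta> *\<^sub>R R (w k) ?x = ?\<nu> - \<beta> *\<^sub>R (A ?x *v dw k)"
      using dual_step[of k]
      by (simp add: bellman_residual_def matrix_vector_mult_diff_distrib algebra_simps)
    have adj: "inner v (adjoint (frechet_derivative (R u) (at ?x)) y) = inner (?DA v *v u - ?Db v) y" for v u y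
      using adjoint_works[OF linear_frechet_derivative_R[OF x]] by (simp add: frechet_derivative_R[OF x])
    have e1: "inner v ?e = inner (?DA v *v dw k) ?\<nu>
        + \<beta> * inner (?DA v *v w k - ?Db v) (A ?x *v dw k)" for v
      unfolding gradient_policy_coupling[OF x] mult inner_diff_right[of v] adj
      by (simp add: matrix_vector_mult_diff_distrib inner_diff_left inner_diff_right algebra_simps)
    have e2: "inner (?DA v *v dw k) ?\<nu> \<le> (\<bar>K1\<bar> * norm v * norm (dw k)) * B" for v
      using DA B by (intro order_trans[OF norm_cauchy_schwarz] mult_mono) auto
    have e3: "\<beta> * inner (?DA v *v w k - ?Db v) (A ?x *v dw k)
        \<le> \<beta> * ((\<bar>K1\<bar> * norm v * B + \<bar>K2\<bar> * norm v) * (KA * norm (dw k)))" for v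
    proof (intro mult_left_mono order_trans[OF norm_cauchy_schwarz] mult_mono KA)
      show "norm (?DA v *v w k - ?Db v) \<le> \<bar>K1\<bar> * norm v * B + \<bar>K2\<bar> * norm v"
        by (intro order_trans[OF norm_triangle_ineq4] add_mono Db order_trans[OF DA] mult_left_mono B) auto
    qed (use B parameters in auto)
    \<comment> \<open>The estimates hold for every direction \<open>v\<close>; choosing
      \<open>?e\<close> itself bounds its norm.\<close>
    have "inner ?e ?e \<le> (\<bar>K1\<bar> * norm ?e * norm (dw k)) * B
        + \<beta> * ((\<bar>K1\<bar> * norm ?e * B + \<bar>K2\<bar> * norm ?e) * (KA * norm (dw k)))"
      using add_mono[OF e2[of ?e] e3[of ?e]] by (simp only: e1[of ?e])
    also have "\<dots> = (C * norm (dw k)) * norm ?e"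
      unfolding C_def by (simp only: algebra_simps)
    finally have "norm ?e * norm ?e \<le> (C * norm (dw k)) * norm ?e"
      by (simp only: power2_norm_eq_inner[symmetric] power2_eq_square)
    then show ?thesis
      using \<open>C \<ge> 0\<close> by (cases "norm ?e = 0") (auto simp: mult_le_cancel_right)
  qed
  ultimately show ?thesis by blast
qed

text \<open>The policy step supplies an explicit subgradient, so the distance is at most the norm of
  one vector. Inserting the gradient of \<open>h k\<close> at the new policy splits it into the
  gradient mismatch, the gradient variation along the segment, and the proximal term.\<close>

lemma stationarity_gap_bound:
  "\<exists>C\<ge>0. \<forall>k. dist_ext 0 ((\<lambda>v. v + adjoint (frechet_derivative (R (w (Suc k))) (at (\<theta> (Suc k)))) (\<nu> (Suc k)))
      ` limiting_subdiff \<psi> (\<theta> (Suc k))) \<le> ereal (C * (norm (d\<theta> k) + norm (dw k)))"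
proof -
  obtain C where C: "0 \<le> C" "\<And>k. norm (adjoint (frechet_derivative (R (w (Suc k))) (at (\<theta> (Suc k)))) (\<nu> (Suc k))
      - gradient (h k) (\<theta> (Suc k))) \<le> C * norm (dw k)"
    using policy_gradient_difference_bound by blast
  have Lbar: "0 \<le> Lbar"
    using lipschitz_on_nonneg[OF grad_lip[of 0]] L_bound[of 0] by simp
  define C' where "C' = C + Lbar + 1 / \<eta>min"
  have "dist_ext 0 ((\<lambda>v. v + adjoint (frechet_derivative (R (w (Suc k))) (at (\<theta> (Suc k)))) (\<nu> (Suc k)))
      ` limiting_subdiff \<psi> (\<theta> (Suc k))) \<le> ereal (C' * (norm (d\<theta> k) + norm (dw k)))" for k
  proof -
    let ?u = "adjoint (frechet_derivative (R (w (Suc k))) (at (\<theta> (Suc k)))) (\<nu> (Suc k))"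
    let ?g = "gradient (h k)"
    \<comment> \<open>The unsimplified factor matches \<open>proximal_step_subgradient\<close> with
      \<open>t = 1 / (2 * \<eta>\<theta> k)\<close>.\<close>
    let ?v = "- ?g (\<theta> k) - (2 * (1 / (2 * \<eta>\<theta> k))) *\<^sub>R d\<theta> k"
    have "?v \<in> limiting_subdiff \<psi> (\<theta> (Suc k))"
      using parameters(3)[of k]
      by (intro proximal_step_subgradient[OF psi] theta_in phi_finite theta_step) auto
    then have "dist_ext 0 ((\<lambda>v. v + ?u) ` limiting_subdiff \<psi> (\<theta> (Suc k))) \<le> ereal (dist 0 (?v + ?u))"
      unfolding dist_ext_def by (intro INF_lower) auto
    also have "ereal (dist 0 (?v + ?u)) \<le> ereal (C' * (norm (d\<theta> k) + norm (dw k)))"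
    proof -
      have "?v + ?u = (?u - ?g (\<theta> (Suc k))) + (?g (\<theta> (Suc k)) - ?g (\<theta> k)) - (1 / \<eta>\<theta> k) *\<^sub>R d\<theta> k"
        by simp
      moreover have "norm (x + y - z) \<le> norm x + norm y + norm z" for x y z :: 'x
        using norm_triangle_ineq[of x y] norm_triangle_ineq4[of "x + y" z] by simp
      ultimately have tri: "norm (?v + ?u) \<le> norm (?u - ?g (\<theta> (Suc k))) + norm (?g (\<theta> (Suc k)) - ?g (\<theta> k))
          + norm ((1 / \<eta>\<theta> k) *\<^sub>R d\<theta> k)"
        by metis
      have lip: "norm (?g (\<theta> (Suc k)) - ?g (\<theta> k)) \<le> Lbar * norm (d\<theta> k)"
        using lipschitz_onD[OF grad_lip[of k], of "\<theta> (Suc k)" "\<theta> k"] mult_right_mono[OF L_bound[of k] norm_ge_zero[of "d\<theta> k"]]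
        by (simp add: dist_norm)
      have prox: "norm ((1 / \<eta>\<theta> k) *\<^sub>R d\<theta> k) \<le> 1 / \<eta>min * norm (d\<theta> k)"
      proof -
        have "1 / \<eta>\<theta> k \<le> 1 / \<eta>min" using eta_lower parameters(3) by (intro divide_left_mono) auto
        from mult_right_mono[OF this norm_ge_zero[of "d\<theta> k"]] show ?thesis
          using parameters(3)[of k] by simp
      qed
      have "norm (?v + ?u) \<le> C * norm (dw k) + Lbar * norm (d\<theta> k) + 1 / \<eta>min * norm (d\<theta> k)"
        using tri C(2)[of k] lip prox by linarith
      also have "\<dots> \<le> C' * (norm (d\<theta> k) + norm (dw k))"
      proof -
        have "0 \<le> C * norm (d\<theta> k)" "0 \<le> Lbar * norm (dw k)" "0 \<le> 1 / \<eta>min * norm (dw k)"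
          using C(1) Lbar eta_lower(1) by auto
        then show ?thesis unfolding C'_def by (simp only: distrib_left distrib_right)
      qed
      finally show ?thesis by simp
    qed
    finally show ?thesis .
  qed
  moreover have "0 \<le> C'" using C(1) Lbar eta_lower(1) by (auto simp: C'_def)
  ultimately show ?thesis by blast
qed

lemma kkt_residual_nonneg: "0 \<le> kkt_residual \<psi> cw A b x u \<mu>"
  unfolding kkt_residual_def by (intro add_nonneg_nonneg zero_le_power_ereal) (auto simp: dist_ext_def intro: INF_greatest)

text \<open>The three summands are controlled separately: policy stationarity by
  \<open>stationarity_gap_bound\<close>, value stationarity by the proximal term left in
  \<open>w_optimality\<close>, and feasibility by the dual increment.\<close>

lemma kkt_residual_bound:
  "\<exists>C\<ge>0. \<forall>k. kkt_residual \<psi> cw A b (\<theta> (Suc k)) (w (Suc k)) (\<nu> (Suc k)) \<le> ereal (C * increment_sq k)"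
proof -
  obtain C where C: "0 \<le> C" "\<And>k. dist_ext 0 ((\<lambda>v. v + adjoint (frechet_derivative (R (w (Suc k))) (at (\<theta> (Suc k)))) (\<nu> (Suc k)))
      ` limiting_subdiff \<psi> (\<theta> (Suc k))) \<le> ereal (C * (norm (d\<theta> k) + norm (dw k)))"
    using stationarity_gap_bound by blast
  define C' where "C' = 2 * C\<^sup>2 + 1 / \<eta>w\<^sup>2 + 1 / \<beta>\<^sup>2"
  have "kkt_residual \<psi> cw A b (\<theta> (Suc k)) (w (Suc k)) (\<nu> (Suc k)) \<le> ereal (C' * increment_sq k)" for k
  proof -
    let ?d = "dist_ext 0 ((\<lambda>v. v + adjoint (frechet_derivative (R (w (Suc k))) (at (\<theta> (Suc k)))) (\<nu> (Suc k)))
      ` limiting_subdiff \<psi> (\<theta> (Suc k)))"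
    let ?D = "C * (norm (d\<theta> k) + norm (dw k))"
    have "0 \<le> ?d" by (auto simp: dist_ext_def intro: INF_greatest)
    then have "?d\<^sup>2 \<le> ereal ?D * ereal ?D"
      unfolding power2_eq_square by (intro ereal_mult_mono C(2)) (use C(1) in auto)
    then have 1: "?d\<^sup>2 \<le> ereal (?D\<^sup>2)" by (simp add: power2_eq_square)
    have "?D\<^sup>2 \<le> 2 * C\<^sup>2 * ((norm (d\<theta> k))\<^sup>2 + (norm (dw k))\<^sup>2)"
    proof -
      have "(norm (d\<theta> k) + norm (dw k))\<^sup>2 \<le> 2 * ((norm (d\<theta> k))\<^sup>2 + (norm (dw k))\<^sup>2)"
        using zero_le_power2[of "norm (d\<theta> k) - norm (dw k)"] by (simp add: power2_eq_square algebra_simps)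
      from mult_left_mono[OF this zero_le_power2[of C]] show ?thesis
        by (simp only: power_mult_distrib mult_ac)
    qed
    also have "\<dots> \<le> 2 * C\<^sup>2 * increment_sq k"
      by (intro mult_left_mono) (auto simp: increment_sq_def)
    finally have 1: "?d\<^sup>2 \<le> ereal (2 * C\<^sup>2 * increment_sq k)"
      using 1 by (meson ereal_less_eq(3) order_trans)
    have "cw + transpose (A (\<theta> (Suc k))) *v \<nu> (Suc k) = - ((1 / \<eta>w) *\<^sub>R dw k)"
      by (simp only: w_optimality) simp
    then have "(norm (cw + transpose (A (\<theta> (Suc k))) *v \<nu> (Suc k)))\<^sup>2 = 1 / \<eta>w\<^sup>2 * (norm (dw k))\<^sup>2"
      by (simp only: norm_minus_cancel) (simp add: power_mult_distrib power_divide)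
    also have "\<dots> \<le> 1 / \<eta>w\<^sup>2 * increment_sq k"
      by (intro mult_left_mono) (auto simp: increment_sq_def)
    finally have 2: "(norm (cw + transpose (A (\<theta> (Suc k))) *v \<nu> (Suc k)))\<^sup>2 \<le> 1 / \<eta>w\<^sup>2 * increment_sq k" .
    have "(norm (R (w (Suc k)) (\<theta> (Suc k))))\<^sup>2 = 1 / \<beta>\<^sup>2 * (norm (d\<nu> k))\<^sup>2"
      using parameters(1) by (simp add: dual_step power_mult_distrib)
    also have "\<dots> \<le> 1 / \<beta>\<^sup>2 * increment_sq k"
      by (intro mult_left_mono) (auto simp: increment_sq_def)
    finally have 3: "(norm (R (w (Suc k)) (\<theta> (Suc k))))\<^sup>2 \<le> 1 / \<beta>\<^sup>2 * increment_sq k" .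
    have "kkt_residual \<psi> cw A b (\<theta> (Suc k)) (w (Suc k)) (\<nu> (Suc k))
        \<le> ereal (2 * C\<^sup>2 * increment_sq k) + ereal (1 / \<eta>w\<^sup>2 * increment_sq k) + ereal (1 / \<beta>\<^sup>2 * increment_sq k)"
      unfolding kkt_residual_def by (intro add_mono 1) (simp_all only: ereal_less_eq 2 3)
    also have "\<dots> = ereal (C' * increment_sq k)" by (simp add: C'_def distrib_right)
    finally show ?thesis .
  qed
  moreover have "0 \<le> C'" by (simp add: C'_def)
  ultimately show ?thesis by blast
qed

section \<open>Monotonicity of the Lyapunov function\<close>

text \<open>If the value does not drop, every term in \<open>lyap_step\<close> vanishes, including
  the older value increment; \<open>dual_difference_bound\<close> then forces the multiplier to
  stand still as well.\<close>

lemma lyap_decrease: "lyap (Suc (Suc k)) \<le> lyap (Suc k)"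
  and lyap_strict_decrease:
    "(\<theta> (Suc (Suc k)), w (Suc (Suc k)), \<nu> (Suc (Suc k))) \<noteq> (\<theta> (Suc k), w (Suc k), \<nu> (Suc k))
      \<Longrightarrow> lyap (Suc (Suc k)) < lyap (Suc k)"
proof -
  let ?a = "\<alpha> * (norm (d\<theta> (Suc k)))\<^sup>2"
    and ?b = "(1 / (2 * \<eta>w) - BB / \<beta> - \<tau>) * (norm (dw (Suc k)))\<^sup>2"
    and ?c = "(\<tau> - BB / \<beta>) * (norm (dw k))\<^sup>2"
  have pos: "0 < 1 / (2 * \<eta>w) - BB / \<beta> - \<tau>" "0 < \<tau> - BB / \<beta>" using tau by auto
  have nonneg: "0 \<le> ?a" "0 \<le> ?b" "0 \<le> ?c"
    using step(1) pos by (intro mult_nonneg_nonneg; simp)+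
  show "lyap (Suc (Suc k)) \<le> lyap (Suc k)" using lyap_step[of k] nonneg by linarith
  assume moved: "(\<theta> (Suc (Suc k)), w (Suc (Suc k)), \<nu> (Suc (Suc k))) \<noteq> (\<theta> (Suc k), w (Suc k), \<nu> (Suc k))"
  show "lyap (Suc (Suc k)) < lyap (Suc k)"
  proof (rule ccontr)
    assume "\<not> ?thesis"
    then have "?a = 0" "?b = 0" "?c = 0" using lyap_step[of k] nonneg by linarith+
    then have zero: "d\<theta> (Suc k) = 0" "dw (Suc k) = 0" "dw k = 0"
      using step(1) pos by simp_all
    then have "(norm (d\<nu> (Suc k)))\<^sup>2 \<le> 0"
      using dual_difference_bound[of k] by simp
    then show False using moved zero by simp
  qed
qed

end

section \<open>Instantiation for the projected Bellman equation\<close>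

theorem theoremF2:
  fixes P :: "'s::finite \<Rightarrow> 'a::finite \<Rightarrow> 's \<Rightarrow> real"
    and r :: "'s \<Rightarrow> 'a \<Rightarrow> real"
    and \<gamma> :: real
    and \<Theta> :: "(real^'p) set"
    and \<pi> :: "real^'p \<Rightarrow> 's \<Rightarrow> 'a \<Rightarrow> real"
    and \<phi> \<psi> :: "real^'p \<Rightarrow> ereal"
    and \<Xi> :: "real^'m^'s"
    and D :: "real^'s^'s"
    and c :: "real^'s"
    and A :: "real^'p \<Rightarrow> real^'m^'m"
    and b :: "real^'p \<Rightarrow> real^'m"
    and cw :: "real^'m"
    and \<beta> \<eta>w \<eta>min \<kappa>A LA AB BB \<tau> Lbar \<alpha> :: real
    and \<eta>\<theta> L :: "nat \<Rightarrow> real"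
    and \<theta> :: "nat \<Rightarrow> real^'p"
    and w \<nu> :: "nat \<Rightarrow> real^'m"
  assumes mdp: "finite_discounted_mdp P \<gamma>"
    and Theta: "closed \<Theta>" "convex \<Theta>"
    and policy_map: "smooth_policy_map \<Theta> \<pi>"
    and psi: "\<psi> = (\<lambda>x. \<phi> x + indicator_ext \<Theta> x)"
    and psi_proper: "proper_fun \<psi>"
    and psi_lsc: "lsc_fun \<psi>"
    and psi_below: "bounded_below_on UNIV \<psi>"
    and features: "rank \<Xi> = CARD('m)" "CARD('m) < CARD('s)"
    and weights: "positive_diagonal D"
    and A: "A = (\<lambda>x. proj_bellman_matrix \<Xi> D P \<gamma> (\<pi> x))"
    and b: "b = (\<lambda>x. proj_bellman_rhs \<Xi> D r (\<pi> x))"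
    and cw: "cw = transpose \<Xi> *v c"
    and parameters: "\<beta> > 0" "\<eta>w > 0" "\<And>k. \<eta>\<theta> k > 0"
    and algorithm: "proj_bellman_admm \<Theta> \<phi> cw A b \<beta> \<eta>w \<eta>\<theta> \<theta> w \<nu>"
    and A_inv: "\<And>x. x \<in> \<Theta> \<Longrightarrow> invertible (A x)"
               "\<And>x. x \<in> \<Theta> \<Longrightarrow> spectral_norm (matrix_inv (A x)) \<le> \<kappa>A"
    and A_lip: "\<And>x y. x \<in> \<Theta> \<Longrightarrow> y \<in> \<Theta> \<Longrightarrow> spectral_norm (A x - A y) \<le> LA * norm (x - y)"
    and DA_bounded: "\<exists>K. \<forall>x\<in>\<Theta>. \<forall>v. spectral_norm (frechet_derivative A (at x) v) \<le> K * norm v"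
    and Db_bounded: "\<exists>K. \<forall>x\<in>\<Theta>. onorm (frechet_derivative b (at x)) \<le> K"
    and reduced_below:
      "bounded_below_on \<Theta> (\<lambda>x. \<phi> x + ereal (inner cw (matrix_inv (A x) *v b x)))"
    and AB: "AB = 3 * \<kappa>A ^ 4 * LA\<^sup>2 * (norm cw)\<^sup>2"
    and BB: "BB = 3 * \<kappa>A\<^sup>2 / \<eta>w\<^sup>2"
    and tau: "BB / \<beta> < \<tau>" "\<tau> < 1 / (2 * \<eta>w) - BB / \<beta>"
    and eta_lower: "0 < \<eta>min" "\<And>k. \<eta>min \<le> \<eta>\<theta> k"
    and grad_lip: "\<And>k. (L k)-lipschitz_on (closed_segment (\<theta> k) (\<theta> (Suc k)))
                          (gradient (policy_coupling A b \<beta> (w k) (\<nu> k)))"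
    and L_bound: "\<And>k. L k \<le> Lbar"
    and step: "\<alpha> > 0" "\<And>k. 1 / (2 * \<eta>\<theta> k) - L k / 2 - AB / \<beta> \<ge> \<alpha>"
  shows "(\<forall>k\<ge>1. lyapunov \<phi> cw A b \<beta> \<tau> \<theta> w \<nu> (Suc k) \<le> lyapunov \<phi> cw A b \<beta> \<tau> \<theta> w \<nu> k
                 \<and> ((\<theta> (Suc k), w (Suc k), \<nu> (Suc k)) \<noteq> (\<theta> k, w k, \<nu> k) \<longrightarrow>
                    lyapunov \<phi> cw A b \<beta> \<tau> \<theta> w \<nu> (Suc k) < lyapunov \<phi> cw A b \<beta> \<tau> \<theta> w \<nu> k))
       \<and> (\<lambda>k. kkt_residual \<psi> cw A b (\<theta> k) (w k) (\<nu> k)) \<longlonglongrightarrow> 0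
       \<and> (\<exists>C::real. \<forall>T\<ge>1. Min ((\<lambda>k. kkt_residual \<psi> cw A b (\<theta> k) (w k) (\<nu> k)) ` {1..T})
                          \<le> ereal (C / real T))"
proof -
  have policy: "policy (\<pi> x)" if "x \<in> \<Theta>" for x
    using policy_map that by (simp add: smooth_policy_map_def)
  have A_bounded: "\<exists>K. \<forall>x\<in>\<Theta>. spectral_norm (A x) \<le> K"
    using proj_bellman_matrix_bounded[of \<Xi> D P \<gamma>] policy unfolding A by blast
  have b_bounded: "\<exists>K. \<forall>x\<in>\<Theta>. norm (b x) \<le> K"
    using proj_bellman_rhs_bounded[of \<Xi> D r] policy unfolding b by blast
  interpret admm: projected_admm \<Theta> \<phi> \<psi> cw A b \<beta> \<eta>w \<eta>min \<kappa>A LA AB BB \<tau> Lbar \<alpha> \<eta>\<theta> L \<theta> w \<nu>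
  proof
    show "A differentiable at x" if "x \<in> \<Theta>" for x
      unfolding A by (rule proj_bellman_matrix_differentiable[OF policy_map that])
    show "b differentiable at x" if "x \<in> \<Theta>" for x
      unfolding b by (rule proj_bellman_rhs_differentiable[OF policy_map that])
  qed (fact Theta psi psi_proper A_bounded b_bounded parameters algorithm A_inv A_lip DA_bounded
      Db_bounded reduced_below AB BB tau eta_lower grad_lip L_bound step)+
  have decrease: "lyapunov \<phi> cw A b \<beta> \<tau> \<theta> w \<nu> (Suc k) \<le> lyapunov \<phi> cw A b \<beta> \<tau> \<theta> w \<nu> k
      \<and> ((\<theta> (Suc k), w (Suc k), \<nu> (Suc k)) \<noteq> (\<theta> k, w k, \<nu> k) \<longrightarrow>
         lyapunov \<phi> cw A b \<beta> \<tau> \<theta> w \<nu> (Suc k) < lyapunov \<phi> cw A b \<beta> \<tau> \<theta> w \<nu> k)" if "k \<ge> 1" for k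
  proof -
    obtain j where k: "k = Suc j" using \<open>k \<ge> 1\<close> by (cases k) auto
    show ?thesis
      unfolding k admm.lyapunov_eq
      using admm.lyap_decrease[of j] admm.lyap_strict_decrease[of j] by auto
  qed
  obtain S where S: "\<And>T. (\<Sum>k<T. admm.increment_sq k) \<le> S"
    using admm.increment_sq_sum_bounded by blast
  obtain C where C: "0 \<le> C"
    "\<And>k. kkt_residual \<psi> cw A b (\<theta> (Suc k)) (w (Suc k)) (\<nu> (Suc k)) \<le> ereal (C * admm.increment_sq k)"
    using admm.kkt_residual_bound by blast
  \<comment> \<open>The rate constant is \<open>C * S\<close>, the residual constant times the bound
    on the summed squared increments.\<close>
  note rate = summable_bound_rate[where G = "\<lambda>k. kkt_residual \<psi> cw A b (\<theta> k) (w k) (\<nu> k)",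
      OF admm.kkt_residual_nonneg admm.increment_sq_nonneg C S]
  show ?thesis
    using decrease rate by blast
qed

end
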